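(* Let $(W,I)$ be a finite Coxeter group. Then $\{w_0^J w_0^I : J\subset I\}$ is a commutative submonoid of $(W,\ast)$. In other words, there exists a commutative monoid structure $\star_I$ on the set of all subsets of $I$ such that for all $J_1,J_2\subset I$, $$T'_{w_0^{J_1}w_0^I}\,T'_{w_0^{J_2}w_0^I}=T'_{w_0^{J_1\star_I J_2}w_0^I}.$$
   Context: $W$ is a Coxeter group generated by simple reflections $s_i$ ($i\in I$). The $0$-Hecke algebra $H$ of $W$ is the $\mathbb{Q}$-algebra generated by $T_{s_i}$ ($i\in I$) subject to $T_{s_i}^2=-T_{s_i}$ and the braid relations of $W$. Put $T'_{s_i}=-T_{s_i}$, and for $w\in W$ with reduced expression $w=s_{i_1}\cdots s_{i_k}$ put $T'_w=T'_{s_{i_1}}\cdots T'_{s_{i_k}}$ (independent of the reduced expression). There is a binary operation $\ast:W\times W\to W$ determined by $T'_xT'_y=T'_{x\ast y}$ for all $x,y\in W$; $(W,\ast)$ is a monoid with unit $1$ (equivalently, $s_i\ast w$ is the Bruhat-larger of $w$ and $s_iw$). For $J\subset I$, $w_0^J$ denotes the maximal (longest) element of the subgroup $W_J$ generated by $s_j$, $j\in J$ (so $w_0^\emptyset=1$). *)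

theory Defs
  imports Complex_Main "HOL-Algebra.Multiplicative_Group" "HOL-Algebra.QuotRing" "HOL-Algebra.Generated_Groups"
begin

section \<open>Coxeter systems\<close>

text \<open>The value of the word \<open>[i\<^sub>1, \<dots>, i\<^sub>k]\<close> under an assignment \<open>s\<close> of its letters in a monoid.\<close>

definition word_val :: "('w, 'm) monoid_scheme \<Rightarrow> ('i \<Rightarrow> 'w) \<Rightarrow> 'i list \<Rightarrow> 'w"
  where "word_val M s ws = foldr (\<lambda>i x. s i \<otimes>\<^bsub>M\<^esub> x) ws \<one>\<^bsub>M\<^esub>"

text \<open>Entries of the Coxeter matrix; \<open>group.ord\<close> is \<open>0\<close> on elements of infinite order, so that
  \<open>0\<close> stands for \<open>\<infinity>\<close>.\<close>

definition cox_m :: "('w, 'm) monoid_scheme \<Rightarrow> ('i \<Rightarrow> 'w) \<Rightarrow> 'i \<Rightarrow> 'i \<Rightarrow> nat"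
  where "cox_m W s i j = group.ord W (s i \<otimes>\<^bsub>W\<^esub> s j)"

text \<open>
  The congruence on the free monoid of words over \<open>I\<close> generated by the relations
  \<open>(s\<^sub>i s\<^sub>j)\<^bsup>m(i,j)\<^esup> = 1\<close>. The case \<open>i = j\<close> is \<open>s\<^sub>i s\<^sub>i = 1\<close>, so the monoid presented by these
  relations is already a group and coincides with the group they present. For \<open>m(i,j) = \<infinity>\<close>
  (encoded as \<open>0\<close>) the relation is vacuous.
\<close>

inductive cox_equiv ::
  "('w, 'm) monoid_scheme \<Rightarrow> 'i set \<Rightarrow> ('i \<Rightarrow> 'w) \<Rightarrow> 'i list \<Rightarrow> 'i list \<Rightarrow> bool"
  for W I s
  where
    rel: "\<lbrakk>i \<in> I; j \<in> I; p \<in> lists I; q \<in> lists I\<rbrakk> \<Longrightarrow>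
      cox_equiv W I s (p @ concat (replicate (cox_m W s i j) [i, j]) @ q) (p @ q)"
  | refl: "u \<in> lists I \<Longrightarrow> cox_equiv W I s u u"
  | sym: "cox_equiv W I s u v \<Longrightarrow> cox_equiv W I s v u"
  | trans: "\<lbrakk>cox_equiv W I s u v; cox_equiv W I s v w\<rbrakk> \<Longrightarrow> cox_equiv W I s u w"

text \<open>
  Coxeter systems in the sense of Bourbaki: a group with a generating family of distinct
  involutions \<open>s i\<close>, \<open>i \<in> I\<close>, for which the relations \<open>(s\<^sub>i s\<^sub>j)\<^bsup>m(i,j)\<^esup> = 1\<close>, with \<open>m(i,j)\<close> the
  order of \<open>s\<^sub>i s\<^sub>j\<close>, form a presentation.
\<close>

locale coxeter_system = group W
  for W :: "('w, 'm) monoid_scheme" (structure) +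
  fixes I :: "'i set" and s :: "'i \<Rightarrow> 'w"
  assumes refl_closed: "s ` I \<subseteq> carrier W"
    and refl_inj: "inj_on s I"
    and refl_ne_one: "i \<in> I \<Longrightarrow> s i \<noteq> \<one>"
    and refl_square: "i \<in> I \<Longrightarrow> s i \<otimes> s i = \<one>"
    and generated: "generate W (s ` I) = carrier W"
    and presentation: "\<lbrakk>u \<in> lists I; v \<in> lists I; word_val W s u = word_val W s v\<rbrakk> \<Longrightarrow>
      cox_equiv W I s u v"

definition cox_length :: "('w, 'm) monoid_scheme \<Rightarrow> 'i set \<Rightarrow> ('i \<Rightarrow> 'w) \<Rightarrow> 'w \<Rightarrow> nat"
  where "cox_length W I s w = (LEAST k. \<exists>ws \<in> lists I. length ws = k \<and> word_val W s ws = w)"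

definition reduced_expr :: "('w, 'm) monoid_scheme \<Rightarrow> 'i set \<Rightarrow> ('i \<Rightarrow> 'w) \<Rightarrow> 'w \<Rightarrow> 'i list \<Rightarrow> bool"
  where "reduced_expr W I s w ws \<longleftrightarrow>
    ws \<in> lists I \<and> word_val W s ws = w \<and> length ws = cox_length W I s w"

text \<open>The longest element \<open>w\<^sub>0\<^sup>J\<close> of the parabolic subgroup \<open>W\<^sub>J\<close>.\<close>

definition longest_elt :: "('w, 'm) monoid_scheme \<Rightarrow> 'i set \<Rightarrow> ('i \<Rightarrow> 'w) \<Rightarrow> 'i set \<Rightarrow> 'w"
  where "longest_elt W I s J = (THE w. w \<in> generate W (s ` J) \<and>
    (\<forall>v \<in> generate W (s ` J). cox_length W I s v \<le> cox_length W I s w))"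


section \<open>The 0-Hecke algebra\<close>

text \<open>
  The free associative unital algebra over the rationals on the letters \<open>I\<close>: finitely supported
  functions on words with the convolution product.
\<close>

definition free_alg :: "'i set \<Rightarrow> ('i list \<Rightarrow> rat) ring"
  where "free_alg I =
    \<lparr>carrier = {f. finite {w. f w \<noteq> 0} \<and> {w. f w \<noteq> 0} \<subseteq> lists I},
     mult = (\<lambda>f g w. \<Sum>k\<le>length w. f (take k w) * g (drop k w)),
     one = (\<lambda>w. if w = [] then 1 else 0),
     zero = (\<lambda>w. 0),
     add = (\<lambda>f g w. f w + g w)\<rparr>"

definition word_elt :: "'i list \<Rightarrow> 'i list \<Rightarrow> rat"
  where "word_elt u = (\<lambda>w. if w = u then 1 else 0)"

text \<open>The alternating word \<open>[i, j, i, \<dots>]\<close> of given length.\<close>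

fun alt_word :: "'i \<Rightarrow> 'i \<Rightarrow> nat \<Rightarrow> 'i list"
  where
    "alt_word i j 0 = []"
  | "alt_word i j (Suc n) = i # alt_word j i n"

text \<open>
  Elements of the free algebra expressing \<open>T\<^sub>i\<^sup>2 = - T\<^sub>i\<close> and the braid relations; the latter are
  trivial for \<open>i = j\<close> and for \<open>m(i,j) = \<infinity>\<close>.
\<close>

definition hecke_relators ::
  "('w, 'm) monoid_scheme \<Rightarrow> 'i set \<Rightarrow> ('i \<Rightarrow> 'w) \<Rightarrow> ('i list \<Rightarrow> rat) set"
  where "hecke_relators W I s =
    {word_elt [i, i] \<oplus>\<^bsub>free_alg I\<^esub> word_elt [i] | i. i \<in> I} \<union>
    {word_elt (alt_word i j (cox_m W s i j)) \<ominus>\<^bsub>free_alg I\<^esub> word_elt (alt_word j i (cox_m W s i j))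
      | i j. i \<in> I \<and> j \<in> I}"

text \<open>
  \<open>Idl\<close> is the two-sided ideal. As the rational scalars are central elements of the free algebra,
  ring ideals are algebra ideals, and the quotient is the algebra with the given presentation;
  the scalar multiplication is multiplication by the classes of the constants.
\<close>

definition hecke_ideal ::
  "('w, 'm) monoid_scheme \<Rightarrow> 'i set \<Rightarrow> ('i \<Rightarrow> 'w) \<Rightarrow> ('i list \<Rightarrow> rat) set"
  where "hecke_ideal W I s = Idl\<^bsub>free_alg I\<^esub> (hecke_relators W I s)"

definition hecke0 ::
  "('w, 'm) monoid_scheme \<Rightarrow> 'i set \<Rightarrow> ('i \<Rightarrow> 'w) \<Rightarrow> ('i list \<Rightarrow> rat) set ring"
  where "hecke0 W I s = free_alg I Quot hecke_ideal W I s"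

definition hecke_T ::
  "('w, 'm) monoid_scheme \<Rightarrow> 'i set \<Rightarrow> ('i \<Rightarrow> 'w) \<Rightarrow> 'i \<Rightarrow> ('i list \<Rightarrow> rat) set"
  where "hecke_T W I s i = hecke_ideal W I s +>\<^bsub>free_alg I\<^esub> word_elt [i]"

definition hecke_T'_gen ::
  "('w, 'm) monoid_scheme \<Rightarrow> 'i set \<Rightarrow> ('i \<Rightarrow> 'w) \<Rightarrow> 'i \<Rightarrow> ('i list \<Rightarrow> rat) set"
  where "hecke_T'_gen W I s i = \<ominus>\<^bsub>hecke0 W I s\<^esub> hecke_T W I s i"

text \<open>\<open>T'\<^sub>w\<close>, computed from an arbitrarily chosen reduced expression of \<open>w\<close>.\<close>

definition hecke_T' ::
  "('w, 'm) monoid_scheme \<Rightarrow> 'i set \<Rightarrow> ('i \<Rightarrow> 'w) \<Rightarrow> 'w \<Rightarrow> ('i list \<Rightarrow> rat) set"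
  where "hecke_T' W I s w =
    word_val (hecke0 W I s) (hecke_T'_gen W I s) (SOME ws. reduced_expr W I s w ws)"

definition star_mult :: "('w, 'm) monoid_scheme \<Rightarrow> 'i set \<Rightarrow> ('i \<Rightarrow> 'w) \<Rightarrow> 'w \<Rightarrow> 'w \<Rightarrow> 'w"
  where "star_mult W I s x y = (THE z. z \<in> carrier W \<and>
    hecke_T' W I s x \<otimes>\<^bsub>hecke0 W I s\<^esub> hecke_T' W I s y = hecke_T' W I s z)"

definition star_monoid :: "('w, 'm) monoid_scheme \<Rightarrow> 'i set \<Rightarrow> ('i \<Rightarrow> 'w) \<Rightarrow> 'w monoid"
  where "star_monoid W I s = \<lparr>carrier = carrier W, mult = star_mult W I s, one = \<one>\<^bsub>W\<^esub>\<rparr>"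


section \<open>The free algebra and its quotient are rings\<close>

lemma free_alg_mult_closed:
  assumes f: "f \<in> carrier (free_alg I)" and g: "g \<in> carrier (free_alg I)"
  shows "f \<otimes>\<^bsub>free_alg I\<^esub> g \<in> carrier (free_alg I)"
proof -
  let ?A = "{w. f w \<noteq> 0}" and ?B = "{w. g w \<noteq> 0}"
  let ?C = "(\<lambda>(u, v). u @ v) ` (?A \<times> ?B)"
  have sub: "{w. (f \<otimes>\<^bsub>free_alg I\<^esub> g) w \<noteq> 0} \<subseteq> ?C"
  proof
    fix w assume "w \<in> {w. (f \<otimes>\<^bsub>free_alg I\<^esub> g) w \<noteq> 0}"
    then have "(\<Sum>k\<le>length w. f (take k w) * g (drop k w)) \<noteq> 0"
      by (simp add: free_alg_def)
    then obtain k where "f (take k w) * g (drop k w) \<noteq> 0"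
      by (rule sum.not_neutral_contains_not_neutral)
    then have "(take k w, drop k w) \<in> ?A \<times> ?B" by simp
    then have "(\<lambda>(u, v). u @ v) (take k w, drop k w) \<in> ?C" by (rule imageI)
    then show "w \<in> ?C" by simp
  qed
  have fin: "finite ?A" "finite ?B" and words: "?A \<subseteq> lists I" "?B \<subseteq> lists I"
    using f g by (simp_all add: free_alg_def)
  have "finite ?C" using fin by (intro finite_imageI finite_cartesian_product)
  moreover have "?C \<subseteq> lists I"
  proof
    fix w assume "w \<in> ?C"
    then obtain u v where uv: "u \<in> ?A" "v \<in> ?B" "w = u @ v"
      by (elim imageE SigmaE) simp
    then have "u \<in> lists I" "v \<in> lists I" using words by (simp_all only: subsetD)
    then show "w \<in> lists I" using uv(3) by simp
  qed
  ultimately have "finite {w. (f \<otimes>\<^bsub>free_alg I\<^esub> g) w \<noteq> 0} \<and>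
      {w. (f \<otimes>\<^bsub>free_alg I\<^esub> g) w \<noteq> 0} \<subseteq> lists I"
    by (intro conjI finite_subset[OF sub] order_trans[OF sub])
  then show ?thesis by (simp add: free_alg_def)
qed

lemma free_alg_mult_assoc:
  "(f \<otimes>\<^bsub>free_alg I\<^esub> g) \<otimes>\<^bsub>free_alg I\<^esub> h = f \<otimes>\<^bsub>free_alg I\<^esub> (g \<otimes>\<^bsub>free_alg I\<^esub> h)"
proof
  fix w :: "'a list"
  let ?n = "length w"
  let ?t = "\<lambda>j k. f (take j w) * g (drop j (take k w)) * h (drop k w)"
  have "((f \<otimes>\<^bsub>free_alg I\<^esub> g) \<otimes>\<^bsub>free_alg I\<^esub> h) w = (\<Sum>k\<le>?n. \<Sum>j\<le>k. ?t j k)"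
    by (auto simp: free_alg_def sum_distrib_right min_def intro!: sum.cong)
  also have "\<dots> = (\<Sum>(k, j) \<in> Sigma {..?n} (\<lambda>k. {..k}). ?t j k)"
    by (rule sum.Sigma) auto
  also have "\<dots> = (\<Sum>(j, k) \<in> Sigma {..?n} (\<lambda>j. {..?n - j}). ?t j (j + k))"
    by (rule sum.reindex_bij_witness[where i = "\<lambda>(j, k). (j + k, j)" and j = "\<lambda>(k, j). (j, k - j)"])
      auto
  also have "\<dots> = (\<Sum>j\<le>?n. \<Sum>k\<le>?n - j. ?t j (j + k))"
    by (rule sum.Sigma[symmetric]) auto
  also have "\<dots> = (f \<otimes>\<^bsub>free_alg I\<^esub> (g \<otimes>\<^bsub>free_alg I\<^esub> h)) w"
    by (auto simp: free_alg_def sum_distrib_left mult.assoc drop_take add.commute intro!: sum.cong)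
  finally show "((f \<otimes>\<^bsub>free_alg I\<^esub> g) \<otimes>\<^bsub>free_alg I\<^esub> h) w
    = (f \<otimes>\<^bsub>free_alg I\<^esub> (g \<otimes>\<^bsub>free_alg I\<^esub> h)) w" .
qed

lemma free_alg_one_mult:
  "\<one>\<^bsub>free_alg I\<^esub> \<otimes>\<^bsub>free_alg I\<^esub> f = f" "f \<otimes>\<^bsub>free_alg I\<^esub> \<one>\<^bsub>free_alg I\<^esub> = f"
proof -
  show "\<one>\<^bsub>free_alg I\<^esub> \<otimes>\<^bsub>free_alg I\<^esub> f = f"
  proof
    fix w :: "'a list"
    have "(\<one>\<^bsub>free_alg I\<^esub> \<otimes>\<^bsub>free_alg I\<^esub> f) w
      = (\<Sum>k\<le>length w. if k = 0 then f w else 0)"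
      unfolding free_alg_def monoid.simps ring.simps by (rule sum.cong) auto
    then show "(\<one>\<^bsub>free_alg I\<^esub> \<otimes>\<^bsub>free_alg I\<^esub> f) w = f w" by simp
  qed
  show "f \<otimes>\<^bsub>free_alg I\<^esub> \<one>\<^bsub>free_alg I\<^esub> = f"
  proof
    fix w :: "'a list"
    have "(f \<otimes>\<^bsub>free_alg I\<^esub> \<one>\<^bsub>free_alg I\<^esub>) w
      = (\<Sum>k\<le>length w. if k = length w then f w else 0)"
      unfolding free_alg_def monoid.simps ring.simps by (rule sum.cong) auto
    then show "(f \<otimes>\<^bsub>free_alg I\<^esub> \<one>\<^bsub>free_alg I\<^esub>) w = f w" by simp
  qed
qed

lemma ring_free_alg: "ring (free_alg I)"
proof (rule ringI)
  show "abelian_group (free_alg I)"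
  proof (rule abelian_groupI)
    fix f g assume "f \<in> carrier (free_alg I)" "g \<in> carrier (free_alg I)"
    moreover have "{w. f w + g w \<noteq> 0} \<subseteq> {w. f w \<noteq> 0} \<union> {w. g w \<noteq> 0}" by auto
    ultimately show "f \<oplus>\<^bsub>free_alg I\<^esub> g \<in> carrier (free_alg I)"
      by (auto simp: free_alg_def intro: finite_subset)
  next
    fix f assume "f \<in> carrier (free_alg I)"
    then show "\<exists>g \<in> carrier (free_alg I). g \<oplus>\<^bsub>free_alg I\<^esub> f = \<zero>\<^bsub>free_alg I\<^esub>"
      by (intro bexI[of _ "\<lambda>w. - f w"]) (auto simp: free_alg_def)
  qed (auto simp: free_alg_def add.assoc add.commute)
  have "{w. (if w = [] then 1 else 0 :: rat) \<noteq> 0} = {[]}" by auto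
  then have one: "\<one>\<^bsub>free_alg I\<^esub> \<in> carrier (free_alg I)"
    by (auto simp: free_alg_def)
  show "Group.monoid (free_alg I)"
    by (rule monoidI)
      (simp_all add: free_alg_mult_closed one free_alg_mult_assoc free_alg_one_mult)
qed (auto simp: free_alg_def ring_distribs sum.distrib)

lemma word_elt_closed: "u \<in> lists I \<Longrightarrow> word_elt u \<in> carrier (free_alg I)"
  by (auto simp: word_elt_def free_alg_def)

lemma alt_word_closed: "\<lbrakk>i \<in> I; j \<in> I\<rbrakk> \<Longrightarrow> alt_word i j n \<in> lists I"
  by (induction i j n rule: alt_word.induct) auto

lemma hecke_relators_closed: "hecke_relators W I s \<subseteq> carrier (free_alg I)"
proof -
  interpret ring "free_alg I" by (rule ring_free_alg)
  show ?thesis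
  proof
    fix f assume "f \<in> hecke_relators W I s"
    then consider i where "i \<in> I" "f = word_elt [i, i] \<oplus>\<^bsub>free_alg I\<^esub> word_elt [i]"
      | i j where "i \<in> I" "j \<in> I" "f = word_elt (alt_word i j (cox_m W s i j))
          \<ominus>\<^bsub>free_alg I\<^esub> word_elt (alt_word j i (cox_m W s i j))"
      unfolding hecke_relators_def by blast
    then show "f \<in> carrier (free_alg I)"
    proof cases
      case 1
      then have "[i, i] \<in> lists I" "[i] \<in> lists I" by auto
      then show ?thesis using 1 by (metis a_closed word_elt_closed)
    next
      case 2
      then show ?thesis by (metis minus_closed word_elt_closed alt_word_closed)
    qed
  qed
qed

lemma ideal_hecke_ideal: "ideal (hecke_ideal W I s) (free_alg I)"
  unfolding hecke_ideal_def by (rule ring.genideal_ideal[OF ring_free_alg hecke_relators_closed])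

lemma ring_hecke0: "ring (hecke0 W I s)"
  unfolding hecke0_def by (rule ideal.quotient_is_ring[OF ideal_hecke_ideal])

end

theory Submission
  imports Defs
begin

text \<open>
  Write \<open>\<star>\<close> for the Demazure product (the operation called \<open>\<ast>\<close> informally) and
  \<open>x\<^sub>J = w\<^sub>0\<^sup>J w\<^sub>0\<^sup>I\<close>. Two observations make the theorem true.

  Closure. Say that \<open>x\<close> slides if for every simple reflection \<open>t\<close> either \<open>x \<star> t = x\<close> or
  \<open>x \<star> t = r \<star> x\<close> for some simple reflection \<open>r\<close>. By associativity a product of sliding elements
  slides (\<open>slides_dmult\<close>): a simple reflection on the right is either absorbed or pushed further
  to the left. The sliding elements are exactly the \<open>x\<^sub>J\<close> (\<open>slides_coset_rep\<close>,
  \<open>slides_imp_coset_rep\<close>). This is the combinatorial form of the condition that \<open>x\<close> sends every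
  simple root to a negative root or to a simple root.

  Commutativity. The map \<open>x \<mapsto> w\<^sub>0\<^sup>I x\<^sup>-\<^sup>1 w\<^sub>0\<^sup>I\<close> preserves length and permutes the simple
  reflections, so it is an anti-automorphism of \<open>\<star>\<close> (\<open>dual_dmult\<close>), and it fixes every \<open>x\<^sub>J\<close>
  because \<open>w\<^sub>0\<^sup>J\<close> and \<open>w\<^sub>0\<^sup>I\<close> are involutions. As \<open>x\<^sub>J \<star> x\<^sub>K\<close> is again some \<open>x\<^sub>L\<close>, applying the
  map to it gives \<open>x\<^sub>J \<star> x\<^sub>K = x\<^sub>K \<star> x\<^sub>J\<close> (\<open>coset_rep_commute\<close>). Since \<open>J\<close> is recovered from
  \<open>x\<^sub>J\<close> (\<open>longest_inj\<close>), the product moves to the set of subsets of \<open>I\<close>.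

  The rest is the theory behind \<open>\<star>\<close>, developed from the presentation of \<open>W\<close>. The exchange
  condition (\<open>exchange\<close>) comes from the parity with which a reflection occurs along a word. It
  makes left and right Demazure operators commute (\<open>ldem_rdem\<close>), so that a composition of left
  operators is determined by its value at \<open>1\<close>. Hence \<open>\<star>\<close> is associative, and the Demazure
  operators satisfy the braid relations because both sides of a braid relation are reduced words
  of the same element. Matsumoto's theorem (\<open>matsumoto\<close>) then gives \<open>T'\<^sub>x T'\<^sub>y = T'\<^sub>x\<^sub>\<star>\<^sub>y\<close>
  (\<open>hecke_T'_mult\<close>). For the operation defined through the algebra to be \<open>\<star>\<close>, the elements
  \<open>T'\<^sub>w\<close> must also be distinct (\<open>hecke_T'_inj\<close>), which is shown by letting words act through
  their Demazure products.
\<close>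

section \<open>Words in a monoid\<close>

context monoid
begin

lemma word_val_Nil [simp]: "word_val G f [] = \<one>"
  by (simp add: word_val_def)

lemma word_val_Cons [simp]: "word_val G f (i # ws) = f i \<otimes> word_val G f ws"
  by (simp add: word_val_def)

lemma word_val_closed: "f ` set ws \<subseteq> carrier G \<Longrightarrow> word_val G f ws \<in> carrier G"
  by (induction ws) auto

lemma word_val_append:
  "f ` set (us @ vs) \<subseteq> carrier G \<Longrightarrow> word_val G f (us @ vs) = word_val G f us \<otimes> word_val G f vs"
  by (induction us) (auto simp: word_val_closed m_assoc image_Un)

end

section \<open>The exchange condition\<close>

context coxeter_system
begin

abbreviation val where "val \<equiv> word_val W s"
abbreviation len where "len \<equiv> cox_length W I s"
abbreviation red where "red \<equiv> reduced_expr W I s"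
abbreviation parab where "parab J \<equiv> generate W (s ` J)"

lemma s_closed [simp]: "i \<in> I \<Longrightarrow> s i \<in> carrier W"
  using refl_closed by auto

lemma s_inv [simp]: "i \<in> I \<Longrightarrow> inv (s i) = s i"
  by (simp add: inv_equality refl_square)

lemma s_cancel [simp]:
  assumes "i \<in> I" "x \<in> carrier W"
  shows "s i \<otimes> (s i \<otimes> x) = x" "x \<otimes> s i \<otimes> s i = x"
  using assms by (simp_all flip: m_assoc add: refl_square) (simp add: m_assoc refl_square)

lemma lists_image: "ws \<in> lists I \<Longrightarrow> s ` set ws \<subseteq> carrier W"
  by auto

lemma val_closed [simp]: "ws \<in> lists I \<Longrightarrow> val ws \<in> carrier W"
  by (simp add: word_val_closed lists_image)

lemma val_append [simp]: "us \<in> lists I \<Longrightarrow> vs \<in> lists I \<Longrightarrow> val (us @ vs) = val us \<otimes> val vs"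
  by (rule word_val_append) (auto simp: lists_image)

lemma val_rev: "ws \<in> lists I \<Longrightarrow> val (rev ws) = inv (val ws)"
  by (induction ws) (auto simp: inv_mult_group in_listsI)

lemma parab_eq_val:
  assumes "J \<subseteq> I"
  shows "parab J = val ` lists J"
proof
  show "parab J \<subseteq> val ` lists J"
  proof
    fix w assume "w \<in> parab J"
    then show "w \<in> val ` lists J"
    proof induction
      case one
      have "val [] = \<one>" "[] \<in> lists J" by auto
      then show ?case by (metis imageI)
    next
      case (incl h)
      then obtain i where "i \<in> J" "h = s i" by auto
      then have "val [i] = h" "[i] \<in> lists J" using assms by auto
      then show ?case by (metis imageI)
    next
      case (inv h)
      then obtain i where "i \<in> J" "h = s i" by auto
      then have "val [i] = inv h" "[i] \<in> lists J" using assms by auto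
      then show ?case by (metis imageI)
    next
      case (eng h1 h2)
      then obtain us vs where uv: "us \<in> lists J" "vs \<in> lists J" "h1 = val us" "h2 = val vs"
        by auto
      then have "us \<in> lists I" "vs \<in> lists I" using lists_mono[OF assms] by blast+
      then have "val (us @ vs) = h1 \<otimes> h2" "us @ vs \<in> lists J"
        using uv by simp_all
      then show ?case by (metis imageI)
    qed
  qed
  have "val ws \<in> parab J" if "ws \<in> lists J" for ws
    using that by (induction ws) (auto intro: generate.intros)
  then show "val ` lists J \<subseteq> parab J" by auto
qed

lemma parab_subset: "J \<subseteq> I \<Longrightarrow> parab J \<subseteq> carrier W"
  by (rule generate_incl) (use refl_closed in auto)

lemma parab_closed: "J \<subseteq> I \<Longrightarrow> x \<in> parab J \<Longrightarrow> x \<in> carrier W"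
  using parab_subset by auto

lemma parab_subgroup: "J \<subseteq> I \<Longrightarrow> subgroup (parab J) W"
  by (rule generate_is_subgroup) (use refl_closed in auto)

lemma val_surj: "w \<in> carrier W \<Longrightarrow> \<exists>ws \<in> lists I. val ws = w"
  using parab_eq_val[of I] generated by auto

text \<open>
  The reflections \<open>t\<^sub>k = (s\<^sub>1 \<dots> s\<^sub>k\<^sub>-\<^sub>1) s\<^sub>k (s\<^sub>1 \<dots> s\<^sub>k\<^sub>-\<^sub>1)\<^sup>-\<^sup>1\<close> of a word: left multiplication
  by \<open>t\<^sub>k\<close> deletes its \<open>k\<close>-th letter. In geometric terms, these are the walls crossed by the
  gallery of the word.
\<close>

primrec refl_seq :: "'i list \<Rightarrow> 'w list" where
  "refl_seq [] = []"
| "refl_seq (i # ws) = s i # map (\<lambda>t. s i \<otimes> t \<otimes> s i) (refl_seq ws)"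

lemma refl_seq_closed: "ws \<in> lists I \<Longrightarrow> set (refl_seq ws) \<subseteq> carrier W"
  by (induction ws) auto

lemma refl_seq_append:
  assumes "us \<in> lists I" "vs \<in> lists I"
  shows "refl_seq (us @ vs) = refl_seq us @ map (\<lambda>t. val us \<otimes> t \<otimes> inv (val us)) (refl_seq vs)"
  using assms
proof (induction us)
  case Nil
  then show ?case using refl_seq_closed[of vs] by (auto intro!: map_idI[symmetric])
next
  case (Cons i us)
  then show ?case using refl_seq_closed[of vs]
    by (auto simp: m_assoc inv_mult_group subset_iff)
qed

lemma count_list_conj:
  assumes "g \<in> carrier W" "t \<in> carrier W" "set ts \<subseteq> carrier W"
  shows "count_list (map (\<lambda>t. g \<otimes> t \<otimes> inv g) ts) t = count_list ts (inv g \<otimes> t \<otimes> g)"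
proof -
  have "g \<otimes> u \<otimes> inv g = t \<longleftrightarrow> u = inv g \<otimes> t \<otimes> g" if "u \<in> carrier W" for u
    using assms that by (metis inv_closed inv_solve_left inv_solve_right m_assoc m_closed)
  then show ?thesis using assms(3) by (induction ts) auto
qed

text \<open>
  With \<open>c = s\<^sub>i s\<^sub>j\<close>, the list for \<open>(i j)\<^sup>n\<close> runs through \<open>c\<^sup>k s\<^sub>i\<close> for \<open>k < 2n\<close>. If \<open>c\<^sup>n = 1\<close>
  it is periodic with period \<open>n\<close>, so every reflection occurs an even number of times. This is
  the invariance of the parity under the defining relations.
\<close>

lemma refl_seq_dihedral:
  assumes "i \<in> I" "j \<in> I"
  shows "refl_seq (concat (replicate n [i, j])) = map (\<lambda>k. (s i \<otimes> s j) [^] k \<otimes> s i) [0..<2 * n]"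
proof (induction n)
  case (Suc n)
  let ?c = "s i \<otimes> s j"
  have c: "?c \<in> carrier W" using assms by auto
  have step: "s i \<otimes> (s j \<otimes> (?c [^] k \<otimes> s i) \<otimes> s j) \<otimes> s i = ?c [^] (Suc (Suc k)) \<otimes> s i" for k
  proof -
    have "?c [^] (Suc (Suc k)) = ?c \<otimes> ?c [^] k \<otimes> ?c"
      using c nat_pow_Suc2[OF c] by simp
    then show ?thesis using assms c by (simp add: m_assoc)
  qed
  have upt: "[0..<2 * Suc n] = 0 # 1 # map (\<lambda>k. Suc (Suc k)) [0..<2 * n]"
    using map_add_upt[of 2 "2 * n"] by (simp add: upt_conv_Cons numeral_2_eq_2 del: upt_Suc)
  have rhs: "map f [0..<2 * Suc n] = f 0 # f 1 # map (\<lambda>k. f (Suc (Suc k))) [0..<2 * n]"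
    for f :: "nat \<Rightarrow> 'w"
    by (simp only: upt list.map map_map comp_def)
  show ?case
    unfolding rhs using assms c by (simp add: Suc.IH step comp_def del: nat_pow_Suc m_assoc)
qed simp

lemma even_count_refl_seq_rel:
  assumes "i \<in> I" "j \<in> I"
  shows "even (count_list (refl_seq (concat (replicate (cox_m W s i j) [i, j]))) t)"
proof -
  let ?c = "s i \<otimes> s j" and ?m = "cox_m W s i j"
  have c: "?c \<in> carrier W" using assms by auto
  have one: "?c [^] ?m = \<one>" using c by (simp add: cox_m_def)
  have "[0..<2 * ?m] = [0..<?m] @ map (\<lambda>k. k + ?m) [0..<?m]"
    using upt_add_eq_append[of 0 ?m ?m] by (simp add: map_add_upt mult_2)
  moreover have "?c [^] (k + ?m) = ?c [^] k" for k :: nat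
    using c one by (simp flip: nat_pow_mult del: nat_pow_Suc)
  ultimately show ?thesis
    by (simp add: refl_seq_dihedral[OF assms] comp_def)
qed

lemma val_rel:
  assumes "i \<in> I" "j \<in> I"
  shows "val (concat (replicate (cox_m W s i j) [i, j])) = \<one>"
proof -
  have "val (concat (replicate n [i, j])) = (s i \<otimes> s j) [^] n" for n
  proof (induction n)
    case (Suc n)
    then show ?case
      using assms nat_pow_Suc2[of "s i \<otimes> s j" n] by (simp add: m_assoc del: nat_pow_Suc)
  qed simp
  then show ?thesis using assms by (simp add: cox_m_def)
qed

text \<open>
  Inserting a relator into a word leaves the reflections before it alone, does not change those
  after it because the relator has value \<open>1\<close>, and adds a conjugate of the even list of the
  relator.
\<close>

lemma cox_equiv_refl_seq:
  assumes "cox_equiv W I s u v"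
  shows "\<forall>t \<in> carrier W. odd (count_list (refl_seq u) t) = odd (count_list (refl_seq v) t)"
  using assms
proof induction
  case (rel i j p q)
  let ?r = "concat (replicate (cox_m W s i j) [i, j])"
  have r: "?r \<in> lists I" using rel by (auto simp: in_lists_conv_set)
  have 1: "map (\<lambda>t. \<one> \<otimes> t \<otimes> inv \<one>) (refl_seq q) = refl_seq q"
    using rel refl_seq_closed[of q] by (auto intro!: map_idI)
  show ?case
    using rel r refl_seq_closed[OF r] refl_seq_closed[of q]
    by (auto simp: refl_seq_append val_rel 1 count_list_conj even_count_refl_seq_rel
        simp del: inv_one l_one r_one)
qed auto

lemma odd_refl_seq_cong:
  assumes "u \<in> lists I" "v \<in> lists I" "val u = val v" "t \<in> carrier W"
  shows "odd (count_list (refl_seq u) t) = odd (count_list (refl_seq v) t)"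
  using cox_equiv_refl_seq[OF presentation] assms by blast

lemma refl_seq_deletion:
  assumes "ws \<in> lists I" "t \<in> set (refl_seq ws)"
  shows "\<exists>p a q. ws = p @ a # q \<and> t \<otimes> val ws = val (p @ q)"
  using assms
proof (induction ws arbitrary: t)
  case (Cons i ws)
  have iws: "i \<in> I" "ws \<in> lists I" using Cons.hyps by simp_all
  show ?case
  proof (cases "t = s i")
    case True
    then have "i # ws = [] @ i # ws \<and> t \<otimes> val (i # ws) = val ([] @ ws)"
      using iws by simp
    then show ?thesis by blast
  next
    case False
    then obtain t' where t': "t' \<in> set (refl_seq ws)" "t = s i \<otimes> t' \<otimes> s i"
      using Cons.prems by auto
    then obtain p a q where "ws = p @ a # q" "t' \<otimes> val ws = val (p @ q)"
      using Cons.IH by blast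
    moreover have "t' \<in> carrier W" using t' iws refl_seq_closed[of ws] by auto
    ultimately have "i # ws = (i # p) @ a # q \<and> t \<otimes> val (i # ws) = val ((i # p) @ q)"
      using t' iws by (simp add: m_assoc)
    then show ?thesis by blast
  qed
qed simp

lemma len_le: "ws \<in> lists I \<Longrightarrow> len (val ws) \<le> length ws"
  unfolding cox_length_def by (rule Least_le) auto

lemma red_exists:
  assumes "w \<in> carrier W"
  shows "\<exists>ws. red w ws"
proof -
  have "\<exists>k. \<exists>ws \<in> lists I. length ws = k \<and> val ws = w" using val_surj[OF assms] by auto
  from LeastI_ex[OF this] show ?thesis
    unfolding reduced_expr_def cox_length_def by auto
qed

lemma redD:
  assumes "red w ws"
  shows "ws \<in> lists I" "val ws = w" "length ws = len w"
  using assms by (auto simp: reduced_expr_def)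

lemma len_mult_le:
  assumes "x \<in> carrier W" "y \<in> carrier W"
  shows "len (x \<otimes> y) \<le> len x + len y"
proof -
  obtain us vs where "red x us" "red y vs" using assms red_exists by metis
  then show ?thesis using len_le[of "us @ vs"] by (auto simp: reduced_expr_def)
qed

lemma len_inv [simp]:
  assumes "x \<in> carrier W"
  shows "len (inv x) = len x"
proof -
  have le: "len (inv x) \<le> len x" if "x \<in> carrier W" for x
  proof -
    obtain us where us: "red x us" using red_exists[OF \<open>x \<in> carrier W\<close>] ..
    note us' = redD[OF us]
    then have "rev us \<in> lists I" by (simp add: in_lists_conv_set)
    from len_le[OF this] us' show ?thesis by (simp add: val_rev)
  qed
  show ?thesis using le[OF assms] le[of "inv x"] assms by simp
qed

lemma len_one [simp]: "len \<one> = 0"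
  using len_le[of "[]"] by simp

lemma len_eq_0: "x \<in> carrier W \<Longrightarrow> len x = 0 \<longleftrightarrow> x = \<one>"
  by (metis red_exists redD len_one length_0_conv word_val_Nil)

text \<open>
  Let \<open>vs\<close> be reduced for \<open>s\<^sub>i w\<close>. The reflection \<open>s\<^sub>i\<close> does not occur in the list of \<open>vs\<close>, for
  deleting a letter would give \<open>w\<close> an expression shorter than \<open>s\<^sub>i w\<close>, against the hypothesis.
  So it occurs exactly once in that of \<open>i # vs\<close>. This is a word for \<open>w\<close>, so by parity \<open>s\<^sub>i\<close>
  occurs in the list of every word for \<open>w\<close>.
\<close>

lemma exchange:
  assumes i: "i \<in> I" and ws: "ws \<in> lists I" and le: "len (s i \<otimes> val ws) \<le> len (val ws)"
  shows "\<exists>p a q. ws = p @ a # q \<and> s i \<otimes> val ws = val (p @ q)"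
proof -
  have "s i \<otimes> val ws \<in> carrier W" using i ws by simp
  then obtain vs where vs: "red (s i \<otimes> val ws) vs" using red_exists by metis
  note vs' = redD[OF vs]
  have "s i \<notin> set (refl_seq vs)"
  proof
    assume "s i \<in> set (refl_seq vs)"
    from refl_seq_deletion[OF vs'(1) this] obtain p a q
      where pq: "vs = p @ a # q" "s i \<otimes> val vs = val (p @ q)" by auto
    then have "val ws = val (p @ q)" using vs' i ws by simp
    moreover have "p @ q \<in> lists I" using vs'(1) pq by simp
    ultimately have "len (val ws) \<le> length (p @ q)" using len_le[of "p @ q"] by simp
    then show False using pq vs' le by simp
  qed
  moreover have "map (\<lambda>t. s i \<otimes> t \<otimes> s i) (refl_seq vs)
      = map (\<lambda>t. s i \<otimes> t \<otimes> inv (s i)) (refl_seq vs)" using i by simp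
  ultimately have "count_list (refl_seq (i # vs)) (s i) = 1"
    using i refl_seq_closed[OF vs'(1)]
    by (simp only: refl_seq.simps count_list.simps)
       (simp add: count_list_conj refl_square del: s_inv)
  moreover have "val (i # vs) = val ws" using vs' i ws by simp
  ultimately have "odd (count_list (refl_seq ws) (s i))"
    using odd_refl_seq_cong[of "i # vs" ws "s i"] i vs'(1) ws by simp
  then have "s i \<in> set (refl_seq ws)"
    by (metis count_list_0_iff even_zero)
  then show ?thesis using refl_seq_deletion ws by blast
qed

lemma len_s_mult:
  assumes "i \<in> I" "x \<in> carrier W"
  shows "len (s i \<otimes> x) = len x + 1 \<or> len x = len (s i \<otimes> x) + 1"
proof -
  have less: "len (s i \<otimes> y) < len y" if le: "len (s i \<otimes> y) \<le> len y" and y: "y \<in> carrier W" for y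
  proof -
    obtain ws where ws: "red y ws" using red_exists[OF y] ..
    then obtain p a q where "ws = p @ a # q" "s i \<otimes> y = val (p @ q)"
      using exchange[of i ws] assms le by (auto simp: reduced_expr_def)
    then show ?thesis using len_le[of "p @ q"] redD[OF ws] by simp
  qed
  have one: "len (s i) \<le> 1" using len_le[of "[i]"] assms by simp
  have "len (s i \<otimes> x) \<le> len x + 1" "len x \<le> len (s i \<otimes> x) + 1"
    using len_mult_le[of "s i" x] len_mult_le[of "s i" "s i \<otimes> x"] one assms by simp_all
  then show ?thesis using less[of x] assms by fastforce
qed

lemma len_mult_s:
  assumes "i \<in> I" "x \<in> carrier W"
  shows "len (x \<otimes> s i) = len x + 1 \<or> len x = len (x \<otimes> s i) + 1"
  using len_s_mult[of i "inv x"] len_inv[of "x \<otimes> s i"] assms by (simp add: inv_mult_group)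

lemma len_s [simp]: "i \<in> I \<Longrightarrow> len (s i) = 1"
  using len_s_mult[of i \<one>] by simp

lemma len_1: "x \<in> carrier W \<Longrightarrow> len x = 1 \<Longrightarrow> \<exists>i \<in> I. x = s i"
  using red_exists[of x] by (auto simp: reduced_expr_def length_Suc_conv)

text \<open>
  The exchange condition deletes a letter of \<open>ws @ [j]\<close> with \<open>ws\<close> reduced for \<open>x\<close>. It cannot be
  one of \<open>ws\<close>, since \<open>s\<^sub>i x\<close> is longer than \<open>x\<close>, so it is the final \<open>j\<close>.
\<close>

lemma crossing:
  assumes "i \<in> I" "j \<in> I" "x \<in> carrier W"
    and "len x < len (s i \<otimes> x)" "len (s i \<otimes> (x \<otimes> s j)) < len (x \<otimes> s j)"
  shows "s i \<otimes> x = x \<otimes> s j"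
proof -
  obtain ws where ws: "red x ws" using red_exists[OF assms(3)] ..
  note ws' = redD[OF ws]
  have v: "val (ws @ [j]) = x \<otimes> s j" using ws' assms by simp
  then obtain p a q where pq: "ws @ [j] = p @ a # q" "s i \<otimes> (x \<otimes> s j) = val (p @ q)"
    using exchange[of i "ws @ [j]"] assms ws' by auto
  show ?thesis
  proof (cases q rule: rev_cases)
    case Nil
    then have "s i \<otimes> (x \<otimes> s j) = x" using pq ws' by simp
    then have "x = s i \<otimes> x \<otimes> s j" using assms by (simp add: m_assoc)
    then have "x \<otimes> s j = s i \<otimes> x \<otimes> s j \<otimes> s j" by (rule arg_cong)
    then show ?thesis using assms by simp
  next
    case (snoc q' b)
    then have q: "ws = p @ a # q'" "b = j" using pq by auto
    then have l: "p @ q' \<in> lists I" using ws' by simp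
    then have "s i \<otimes> x \<otimes> s j = val (p @ q') \<otimes> s j"
      using pq snoc q assms ws'(1) by (simp add: m_assoc)
    then have "s i \<otimes> x = val (p @ q')"
      using l assms by (metis m_closed right_cancel s_closed val_closed)
    then have "len (s i \<otimes> x) \<le> length (p @ q')" using len_le[OF l] by simp
    then show ?thesis using q ws' assms by simp
  qed
qed

lemma parab_red_exists:
  assumes J: "J \<subseteq> I" and x: "x \<in> parab J"
  shows "\<exists>ws \<in> lists J. red x ws"
proof -
  have "\<exists>vs \<in> lists J. red (val ws) vs" if "ws \<in> lists J" for ws
    using that
  proof (induction ws)
    case Nil
    then show ?case by (intro bexI[of _ "[]"]) (auto simp: reduced_expr_def)
  next
    case (Cons i ws)
    then obtain vs where vs: "vs \<in> lists J" "red (val ws) vs" by auto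
    have i: "i \<in> I" "i \<in> J" using Cons J by auto
    note vs' = redD[OF vs(2)]
    show ?case
    proof (cases "len (s i \<otimes> val ws) \<le> len (val ws)")
      case True
      then obtain p a q where pq: "vs = p @ a # q" "s i \<otimes> val vs = val (p @ q)"
        using exchange[of i vs] i vs' by auto
      have "len (val ws) = len (s i \<otimes> val ws) + 1"
        using True len_s_mult[of i "val ws"] i vs' val_closed[OF vs'(1)] by auto
      then have "red (val (i # ws)) (p @ q)" using pq vs' by (auto simp: reduced_expr_def)
      then show ?thesis using pq vs(1) by (intro bexI[of _ "p @ q"]) auto
    next
      case False
      then have "len (s i \<otimes> val ws) = len (val ws) + 1"
        using len_s_mult[of i "val ws"] i vs' val_closed[OF vs'(1)] by auto
      then have "red (val (i # ws)) (i # vs)" using vs' i by (auto simp: reduced_expr_def)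
      then show ?thesis using i vs(1) by (intro bexI[of _ "i # vs"]) auto
    qed
  qed
  then show ?thesis using x parab_eq_val[OF J] by auto
qed

section \<open>The Demazure product\<close>

text \<open>
  The Demazure operators: the Bruhat-larger of \<open>x\<close> and \<open>s\<^sub>i x\<close>, or of \<open>x\<close> and \<open>x s\<^sub>i\<close>, which is
  the longer of the two.
\<close>

definition ldem :: "'i \<Rightarrow> 'w \<Rightarrow> 'w" where
  "ldem i x = (if len x < len (s i \<otimes> x) then s i \<otimes> x else x)"

definition rdem :: "'i \<Rightarrow> 'w \<Rightarrow> 'w" where
  "rdem i x = (if len x < len (x \<otimes> s i) then x \<otimes> s i else x)"

lemma ldem_closed [simp]: "i \<in> I \<Longrightarrow> x \<in> carrier W \<Longrightarrow> ldem i x \<in> carrier W"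
  by (simp add: ldem_def)

lemma rdem_closed [simp]: "i \<in> I \<Longrightarrow> x \<in> carrier W \<Longrightarrow> rdem i x \<in> carrier W"
  by (simp add: rdem_def)

lemma inv_ldem: "i \<in> I \<Longrightarrow> x \<in> carrier W \<Longrightarrow> inv (ldem i x) = rdem i (inv x)"
  using len_inv[of "s i \<otimes> x"] by (auto simp: ldem_def rdem_def inv_mult_group)

text \<open>
  The only configuration that is not settled by lengths is the one where \<open>s\<^sub>i\<close> and \<open>s\<^sub>j\<close> both
  lengthen \<open>x\<close> but together do not. There the lemma \<open>crossing\<close> says that \<open>s\<^sub>i x = x s\<^sub>j\<close>.
\<close>

lemma ldem_rdem:
  assumes i: "i \<in> I" and j: "j \<in> I" and x: "x \<in> carrier W"
  shows "ldem i (rdem j x) = rdem j (ldem i x)"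
proof -
  let ?a = "s i \<otimes> x" and ?b = "x \<otimes> s j" and ?ab = "s i \<otimes> (x \<otimes> s j)"
  have assoc: "s i \<otimes> x \<otimes> s j = ?ab" using assms by (simp add: m_assoc)
  have cl: "?a \<in> carrier W" "?b \<in> carrier W" using assms by auto
  note lens = len_s_mult[OF i x] len_mult_s[OF j x] len_s_mult[OF i cl(2)]
    len_mult_s[OF j cl(1), unfolded assoc]
  consider (up) "len x < len ?a" "len x < len ?b" "len ?b < len ?ab"
    | (cross) "len x < len ?a" "len x < len ?b" "len ?ab < len ?b"
    | "\<not> (len x < len ?a \<and> len x < len ?b)"
    using lens by linarith
  then show ?thesis
  proof cases
    case up
    then have "len ?a < len ?ab" using lens by linarith
    then show ?thesis using up assoc by (simp add: ldem_def rdem_def)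
  next
    case cross
    then have "?a = ?b" using crossing assms by simp
    moreover have "\<not> len ?a < len ?ab" "\<not> len ?b < len ?ab" using cross lens by linarith+
    ultimately show ?thesis using cross assoc by (simp add: ldem_def rdem_def)
  next
    case 3
    then show ?thesis using lens assoc by (auto simp: ldem_def rdem_def)
  qed
qed

abbreviation lact where "lact \<equiv> foldr ldem"

text \<open>
  The Demazure product of the letters, which agrees with the value of the word if the word is
  reduced (\<open>dem_red\<close>).
\<close>

definition dem :: "'i list \<Rightarrow> 'w" where
  "dem ws = lact ws \<one>"

lemma lact_closed [simp]: "ws \<in> lists I \<Longrightarrow> x \<in> carrier W \<Longrightarrow> lact ws x \<in> carrier W"
  by (induction ws) auto

lemma dem_closed [simp]: "ws \<in> lists I \<Longrightarrow> dem ws \<in> carrier W"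
  by (simp add: dem_def)

lemma dem_Nil [simp]: "dem [] = \<one>"
  by (simp add: dem_def)

lemma dem_Cons [simp]: "dem (i # ws) = ldem i (dem ws)"
  by (simp add: dem_def)

lemma ldem_one [simp]: "i \<in> I \<Longrightarrow> ldem i \<one> = s i"
  by (simp add: ldem_def)

lemma rdem_one [simp]: "i \<in> I \<Longrightarrow> rdem i \<one> = s i"
  by (simp add: rdem_def)

lemma lact_rdem: "ws \<in> lists I \<Longrightarrow> j \<in> I \<Longrightarrow> x \<in> carrier W \<Longrightarrow> lact ws (rdem j x) = rdem j (lact ws x)"
  by (induction ws) (auto simp: ldem_rdem)

text \<open>
  Commutation moves the letters of \<open>ws\<close> to the right-hand side of \<open>1\<close>. So the operator of a word
  \<open>ps\<close> is determined by its value \<open>dem ps\<close> at \<open>1\<close>, which makes the product \<open>\<star>\<close> below well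
  defined and associative.
\<close>

lemma lact_dem:
  assumes "ps \<in> lists I" "ws \<in> lists I"
  shows "lact ps (dem ws) = foldr rdem (rev ws) (dem ps)"
proof -
  have rd: "foldr rdem (rev us) x \<in> carrier W" if "us \<in> lists I" "x \<in> carrier W" for us x
    using that by (induction us rule: rev_induct) auto
  have push: "lact us (foldr rdem (rev ws) x) = foldr rdem (rev ws) (lact us x)"
    if "us \<in> lists I" "x \<in> carrier W" for us x
    using assms(2) that
  proof (induction ws rule: rev_induct)
    case (snoc j ws)
    then show ?case using rd[of ws x] lact_rdem[of us j "foldr rdem (rev ws) x"] by simp
  qed simp
  have "dem ws = foldr rdem (rev ws) \<one>"
    using assms(2)
  proof (induction ws)
    case (Cons i ws)
    have "dem (i # ws) = lact [i] (foldr rdem (rev ws) \<one>)" using Cons by simp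
    also have "\<dots> = foldr rdem (rev ws) (s i)"
    proof -
      have "ldem i (foldr rdem (rev us) \<one>) = foldr rdem (rev us) (s i)" if "us \<in> lists I" for us
        using that
      proof (induction us rule: rev_induct)
        case (snoc j us)
        then show ?case using rd[of us \<one>] ldem_rdem[of i j "foldr rdem (rev us) \<one>"] Cons.hyps
          by simp
      qed (use Cons.hyps in simp)
      then show ?thesis using Cons.hyps by simp
    qed
    finally show ?case using Cons.hyps by simp
  qed simp
  then show ?thesis using push[of ps \<one>] assms(1) by (simp add: dem_def)
qed

lemma red_Cons:
  assumes "red w (i # ws)"
  shows "i \<in> I" "red (val ws) ws" "w = s i \<otimes> val ws" "len w = len (val ws) + 1"
    "ldem i (val ws) = w"
proof -
  have i: "i \<in> I" and ws: "ws \<in> lists I" and w: "w = s i \<otimes> val ws" "len w = length ws + 1"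
    using assms by (auto simp: reduced_expr_def)
  have "len w \<le> len (val ws) + 1" using len_s_mult[of i "val ws"] i ws w by auto
  then have l: "len (val ws) = length ws" using len_le[OF ws] w by simp
  show "i \<in> I" "red (val ws) ws" "w = s i \<otimes> val ws" "len w = len (val ws) + 1"
    using i ws w l by (auto simp: reduced_expr_def)
  then show "ldem i (val ws) = w" by (simp add: ldem_def)
qed

lemma red_ConsI:
  assumes "red x ws" "i \<in> I" "len x < len (s i \<otimes> x)"
  shows "red (s i \<otimes> x) (i # ws)"
  using assms len_s_mult[of i x] val_closed[OF redD(1)[OF assms(1)]]
  by (auto simp: reduced_expr_def)

lemma dem_red: "red w ws \<Longrightarrow> dem ws = w"
proof (induction ws arbitrary: w)
  case Nil
  then show ?case by (auto simp: reduced_expr_def)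
next
  case (Cons i ws)
  then show ?case using red_Cons[OF Cons.prems] by auto
qed

lemma dem_surj: "w \<in> carrier W \<Longrightarrow> \<exists>ws \<in> lists I. dem ws = w"
  using red_exists dem_red redD(1) by blast

lemma lact_cong:
  assumes "ps \<in> lists I" "qs \<in> lists I" "dem ps = dem qs" "x \<in> carrier W"
  shows "lact ps x = lact qs x"
  using assms dem_surj[of x] lact_dem by metis

text \<open>
  By \<open>lact_cong\<close> any word with Demazure product \<open>x\<close> could be taken in place of the chosen
  reduced word; see \<open>dmult_lact\<close>.
\<close>

definition dmult :: "'w \<Rightarrow> 'w \<Rightarrow> 'w" (infixl "\<star>" 70) where
  "x \<star> y = lact (SOME ws. red x ws) y"

lemma dmult_lact:
  assumes "ws \<in> lists I" "dem ws = x" "y \<in> carrier W"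
  shows "x \<star> y = lact ws y"
proof -
  have "x \<in> carrier W" using assms(1,2) dem_closed by blast
  then have "red x (SOME ws. red x ws)" using red_exists by (metis someI_ex)
  then show ?thesis
    unfolding dmult_def using assms dem_red redD(1) by (metis lact_cong)
qed

lemma dem_append:
  assumes "us \<in> lists I" "vs \<in> lists I"
  shows "dem (us @ vs) = dem us \<star> dem vs"
  using dmult_lact[OF assms(1) HOL.refl, of "dem vs"] assms by (simp add: dem_def)

lemma dmult_closed [simp]: "x \<in> carrier W \<Longrightarrow> y \<in> carrier W \<Longrightarrow> x \<star> y \<in> carrier W"
  using dem_surj[of x] by (metis dmult_lact lact_closed)

lemma dmult_assoc:
  assumes "x \<in> carrier W" "y \<in> carrier W" "z \<in> carrier W"
  shows "x \<star> y \<star> z = x \<star> (y \<star> z)"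
proof -
  obtain us vs ws where "us \<in> lists I" "vs \<in> lists I" "ws \<in> lists I"
    and "x = dem us" "y = dem vs" "z = dem ws" using assms dem_surj by metis
  then show ?thesis by (simp flip: dem_append)
qed

lemma dmult_one [simp]:
  assumes "x \<in> carrier W"
  shows "\<one> \<star> x = x" "x \<star> \<one> = x"
proof -
  show "\<one> \<star> x = x" using dmult_lact[of "[]" \<one> x] assms by simp
  obtain ws where "ws \<in> lists I" "dem ws = x" using assms dem_surj by metis
  then show "x \<star> \<one> = x" using dmult_lact[of ws x \<one>] by (simp add: dem_def)
qed

lemma s_dmult [simp]: "i \<in> I \<Longrightarrow> x \<in> carrier W \<Longrightarrow> s i \<star> x = ldem i x"
  using dmult_lact[of "[i]" "s i" x] by simp

lemma dmult_s [simp]: "i \<in> I \<Longrightarrow> x \<in> carrier W \<Longrightarrow> x \<star> s i = rdem i x"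
proof -
  assume i: "i \<in> I" and x: "x \<in> carrier W"
  then obtain ws where ws: "ws \<in> lists I" "dem ws = x" using dem_surj by metis
  then have "x \<star> s i = lact ws (rdem i \<one>)" using dmult_lact[of ws x "s i"] i by simp
  also have "\<dots> = rdem i (lact ws \<one>)" by (rule lact_rdem) (use ws i in auto)
  finally show ?thesis using ws by (simp add: dem_def)
qed

section \<open>Alternating words\<close>

text \<open>
  Cancelling adjacent equal letters turns a word in \<open>i\<close> and \<open>j\<close> into an alternating one and
  keeps the parity of the length.
\<close>

lemma val_dihedral_word:
  assumes ij: "i \<in> I" "j \<in> I" and ws: "set ws \<subseteq> {i, j}"
  shows "\<exists>a b k. {a, b} = {i, j} \<and> k \<le> length ws \<and> even k = even (length ws) \<and>
    val ws = val (alt_word a b k)"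
  using ws
proof (induction ws)
  case Nil
  have "{i, j} = {i, j} \<and> 0 \<le> length [] \<and> even (0::nat) = even (length []) \<and>
      val [] = val (alt_word i j 0)"
    by simp
  then show ?case by (metis list.size(3) )
next
  case (Cons c ws)
  then obtain a b k where ab: "{a, b} = {i, j}" "k \<le> length ws" "even k = even (length ws)"
    "val ws = val (alt_word a b k)" by auto
  have abI: "a \<in> I" "b \<in> I" using ab ij by (auto simp: doubleton_eq_iff)
  have c: "c = a \<or> c = b" using Cons.prems ab by auto
  show ?case
  proof (cases k)
    case 0
    obtain d where "{c, d} = {i, j}" using c ab by auto
    moreover have "val (c # ws) = val (alt_word c d 1)" using ab 0 by simp
    moreover have "1 \<le> length (c # ws)" "even (1::nat) = even (length (c # ws))" using ab 0 by auto
    ultimately show ?thesis by blast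
  next
    case (Suc n)
    show ?thesis
    proof (cases "c = a")
      case True
      have "alt_word b a n \<in> lists I" using abI by (simp add: alt_word_closed)
      then have "val (c # ws) = val (alt_word b a n)" using ab Suc True abI by simp
      moreover have "n \<le> length (c # ws)" "even n = even (length (c # ws))" "{b, a} = {i, j}"
        using ab Suc by auto
      ultimately show ?thesis by blast
    next
      case False
      then have "val (c # ws) = val (alt_word b a (Suc k))" using c ab by simp
      moreover have "Suc k \<le> length (c # ws)" "even (Suc k) = even (length (c # ws))"
        "{b, a} = {i, j}" using ab by auto
      ultimately show ?thesis by blast
    qed
  qed
qed

lemma length_alt_word [simp]: "length (alt_word i j k) = k"
  by (induction i j k rule: alt_word.induct) auto

lemma set_alt_word: "set (alt_word i j k) \<subseteq> {i, j}"
  by (induction i j k rule: alt_word.induct) auto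

lemma val_alt_word:
  assumes "i \<in> I" "j \<in> I"
  shows "val (alt_word i j (2 * n)) = (s i \<otimes> s j) [^] int n"
    and "val (alt_word i j (2 * n + 1)) = (s i \<otimes> s j) [^] int n \<otimes> s i"
    and "val (alt_word j i (2 * n)) = (s i \<otimes> s j) [^] (- int n)"
    and "val (alt_word j i (2 * n + 1)) = (s i \<otimes> s j) [^] (- int n - 1) \<otimes> s i"
proof -
  let ?c = "s i \<otimes> s j"
  have c: "?c \<in> carrier W" using assms by simp
  have even: "val (alt_word a b (2 * n)) = (s a \<otimes> s b) [^] n"
    if "a \<in> I" "b \<in> I" for a b n
  proof (induction n)
    case (Suc n)
    then show ?case using that nat_pow_Suc2[of "s a \<otimes> s b" n]
      by (simp add: m_assoc del: nat_pow_Suc)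
  qed simp
  have inv_c: "s j \<otimes> s i = inv ?c" using assms by (simp add: inv_mult_group)
  show e1: "val (alt_word i j (2 * n)) = ?c [^] int n" for n
    using even assms by (simp add: int_pow_int)
  show e2: "val (alt_word j i (2 * n)) = ?c [^] (- int n)" for n
    using even[of j i n] assms c by (simp add: inv_c int_pow_neg_int nat_pow_inv)
  have j: "s j \<otimes> x = inv ?c \<otimes> (s i \<otimes> x)" if "x \<in> carrier W" for x
    using assms that by (simp flip: inv_c add: m_assoc)
  have alt: "alt_word a b (2 * n + 1) = a # alt_word b a (2 * n)" for a b :: 'i and n
    by simp
  have swap: "s i \<otimes> ?c [^] (- int n) = ?c [^] int n \<otimes> s i" for n
  proof (induction n)
    case (Suc n)
    have "?c [^] (- int (Suc n)) = inv ?c \<otimes> ?c [^] (- int n)"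
      using int_pow_mult[OF c, of "-1" "- int n"] c by (simp add: int_pow_neg)
    then have "s i \<otimes> ?c [^] (- int (Suc n)) = ?c \<otimes> (s i \<otimes> ?c [^] (- int n))"
      using assms by (simp flip: inv_c add: m_assoc)
    also have "\<dots> = ?c \<otimes> ?c [^] int n \<otimes> s i" using Suc c assms by (simp add: m_assoc)
    also have "?c \<otimes> ?c [^] int n = ?c [^] int (Suc n)"
      using int_pow_mult[OF c, of 1 "int n"] c by simp
    finally show ?case .
  qed (use assms in simp)
  show "val (alt_word i j (2 * n + 1)) = ?c [^] int n \<otimes> s i"
    unfolding alt by (simp add: e2 swap)
  have swap': "s i \<otimes> ?c [^] int n = ?c [^] (- int n) \<otimes> s i"
  proof -
    have "?c [^] (- int n) \<otimes> s i = s i \<otimes> (s i \<otimes> ?c [^] (- int n)) \<otimes> s i"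
      using assms c by simp
    also have "\<dots> = s i \<otimes> ?c [^] int n"
      unfolding swap using assms c by (simp add: m_assoc refl_square)
    finally show ?thesis by simp
  qed
  have "val (alt_word j i (2 * n + 1)) = inv ?c \<otimes> (s i \<otimes> ?c [^] int n)"
    unfolding alt word_val_Cons e1 using c by (intro j) simp
  also have "\<dots> = ?c [^] (- 1 + - int n) \<otimes> s i"
    unfolding swap' int_pow_mult[OF c] using assms c by (simp add: int_pow_neg m_assoc)
  also have "- 1 + - int n = - int n - 1" by simp
  finally show "val (alt_word j i (2 * n + 1)) = ?c [^] (- int n - 1) \<otimes> s i" .
qed

text \<open>
  In powers of \<open>c = s\<^sub>i s\<^sub>j\<close>, an equality would say \<open>c\<^sup>d = 1\<close> with \<open>0 < d < k\<close>, whereas \<open>c\<close> has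
  order \<open>m \<ge> k\<close> or infinite order. Words of equal parity suffice, as the exchange condition
  removes letters in pairs.
\<close>

lemma alt_word_shorter_neq:
  assumes ij: "i \<in> I" "j \<in> I" and ab: "{a, b} = {i, j}"
    and k: "k \<le> cox_m W s i j \<or> cox_m W s i j = 0" and l: "l < k" "even l = even k"
  shows "val (alt_word i j k) \<noteq> val (alt_word a b l)"
proof
  assume eq: "val (alt_word i j k) = val (alt_word a b l)"
  let ?c = "s i \<otimes> s j" and ?m = "cox_m W s i j"
  have c: "?c \<in> carrier W" using ij by simp
  obtain n r where n: "k = 2 * n + r" "r < 2"
    by (metis mod_less_divisor mult_div_mod_eq zero_less_numeral)
  obtain n' where n': "l = 2 * n' + r"
    using n l by (cases "even k") (auto elim!: evenE oddE simp: less_2_cases_iff)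
  have ab: "a = i \<and> b = j \<or> a = j \<and> b = i" using ab by (auto simp: doubleton_eq_iff)
  have pow: "d = 0" if "?c [^] (x::int) = ?c [^] y" "x - y = int d" "d < k" for x y d
  proof -
    have "?c [^] (x - y) = \<one>" unfolding int_pow_diff[OF c] that(1) using c by simp
    then have "?c [^] d = \<one>" unfolding that(2) int_pow_int .
    then have "?m dvd d" using c by (simp add: cox_m_def pow_eq_id)
    then show "d = 0" using that k by (auto dest: dvd_imp_le)
  qed
  have cancel: "?c [^] x = ?c [^] y" if "?c [^] x \<otimes> s i = ?c [^] y \<otimes> s i" for x y :: int
    using that c ij by (metis int_pow_closed right_cancel s_closed)
  have lt: "n' < n" using l(1) n(1) n' by simp
  then have d: "n - n' < k" "int n - int n' = int (n - n')" "n - n' \<noteq> 0" using n(1) by auto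
  from n(2) consider "r = 0" | "r = 1" by linarith
  then show False
  proof cases
    case 1
    then have "?c [^] int n = ?c [^] int n' \<or> ?c [^] int n = ?c [^] (- int n')"
      using eq ab n n' val_alt_word[OF ij] by auto
    then show False
      using pow[OF _ d(2,1)] d(3) pow[of "int n" "- int n'" "n + n'"] lt n(1) 1 by auto
  next
    case 2
    then have "?c [^] int n = ?c [^] int n' \<or> ?c [^] int n = ?c [^] (- int n' - 1)"
      using eq ab n n' val_alt_word[OF ij] cancel by metis
    then show False
      using pow[OF _ d(2,1)] d(3) pow[of "int n" "- int n' - 1" "n + n' + 1"] lt n(1) 2 by auto
  qed
qed

lemma cox_m_sym: "i \<in> I \<Longrightarrow> j \<in> I \<Longrightarrow> cox_m W s j i = cox_m W s i j"
  using ord_inv[of "s i \<otimes> s j"] by (simp add: cox_m_def inv_mult_group)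

lemma red_alt_word:
  assumes "i \<in> I" "j \<in> I" "k \<le> cox_m W s i j \<or> cox_m W s i j = 0"
  shows "red (val (alt_word i j k)) (alt_word i j k)"
  using assms
proof (induction i j k rule: alt_word.induct)
  case (1 i j)
  then show ?case by (simp add: reduced_expr_def)
next
  case (2 i j k)
  let ?v = "alt_word j i k"
  have m: "cox_m W s j i = cox_m W s i j"
    using 2 by (simp add: cox_m_sym)
  have v: "red (val ?v) ?v" using 2 m by auto
  have "len (val ?v) < len (s i \<otimes> val ?v)"
  proof (rule ccontr)
    assume "\<not> ?thesis"
    then obtain p a q where pq: "?v = p @ a # q" "s i \<otimes> val ?v = val (p @ q)"
      using exchange[of i ?v] 2 v redD(1) by auto
    then have "set (p @ q) \<subseteq> {i, j}" using set_alt_word[of j i k] by auto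
    from val_dihedral_word[OF 2(2,3) this] obtain a' b' l where
      l: "{a', b'} = {i, j}" "l \<le> length (p @ q)" "even l = even (length (p @ q))"
        "val (p @ q) = val (alt_word a' b' l)" by blast
    moreover have "length (p @ q) + 2 = Suc k" using pq(1) length_alt_word[of j i k] by simp
    ultimately show False
      using alt_word_shorter_neq[of i j a' b' "Suc k" l] 2 pq(2) by auto
  qed
  then show ?case using red_ConsI[OF v] 2 by simp
qed

lemma val_alt_word_m:
  assumes "i \<in> I" "j \<in> I"
  shows "val (alt_word i j (cox_m W s i j)) = val (alt_word j i (cox_m W s i j))"
proof -
  let ?c = "s i \<otimes> s j" and ?m = "cox_m W s i j"
  have c: "?c \<in> carrier W" using assms by simp
  have "?c [^] int ?m = \<one>" using c by (simp add: cox_m_def int_pow_int)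
  then have shift: "?c [^] (x + int ?m) = ?c [^] x" for x :: int
    using int_pow_mult[OF c, of x "int ?m"] c by simp
  show ?thesis
  proof (cases "even ?m")
    case True
    then obtain n where n: "?m = 2 * n" by (auto elim: evenE)
    show ?thesis using shift[of "- int n"] val_alt_word[OF assms, of n] by (simp add: n)
  next
    case False
    then obtain n where n: "?m = 2 * n + 1" by (auto elim: oddE)
    show ?thesis
      using shift[of "- int n - 1"] val_alt_word(2,4)[OF assms, of n] unfolding n by simp
  qed
qed

text \<open>
  The braid relations for Demazure operators. By \<open>lact_dem\<close> it suffices to compare the values at
  \<open>1\<close>, and these are ordinary products because the alternating words are reduced.
\<close>

lemma dem_alt_word_m:
  assumes "i \<in> I" "j \<in> I"
  shows "dem (alt_word i j (cox_m W s i j)) = dem (alt_word j i (cox_m W s i j))"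
proof -
  have "dem (alt_word i j (cox_m W s i j)) = val (alt_word i j (cox_m W s i j))"
    using assms by (intro dem_red red_alt_word) auto
  moreover have "dem (alt_word j i (cox_m W s i j)) = val (alt_word j i (cox_m W s i j))"
    using assms by (intro dem_red red_alt_word) (auto simp: cox_m_sym)
  ultimately show ?thesis using val_alt_word_m[OF assms] by simp
qed

section \<open>Matsumoto's theorem\<close>

text \<open>
  If \<open>w\<close> has the descents \<open>s\<^sub>i\<close> and \<open>s\<^sub>j\<close>, the prefix grows one letter at a time. The exchange
  condition for the descent opposite to the current first letter deletes a letter behind the
  prefix, since a deletion inside it would shorten a reduced alternating word.
\<close>

lemma red_alt_prefix:
  assumes ij: "i \<in> I" "j \<in> I" "i \<noteq> j" and w: "w \<in> carrier W"
    and desc: "len (s i \<otimes> w) < len w" "len (s j \<otimes> w) < len w"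
    and k: "k \<le> cox_m W s i j \<or> cox_m W s i j = 0"
  shows "\<exists>vs. red w (alt_word i j k @ vs)"
  using assms
proof (induction i j k rule: alt_word.induct)
  case (1 i j)
  then show ?case using red_exists by auto
next
  case (2 i j k)
  let ?v = "alt_word j i k"
  have m: "k \<le> cox_m W s j i \<or> cox_m W s j i = 0" using 2 cox_m_sym by auto
  then obtain vs where vs: "red w (?v @ vs)" using 2 by blast
  note vs' = redD[OF vs]
  from exchange[of i "?v @ vs"] obtain p a q
    where pq: "?v @ vs = p @ a # q" "s i \<otimes> w = val (p @ q)"
    using 2 vs' by auto
  have pqI: "p @ q \<in> lists I" using pq vs' by (metis append_in_lists_conv listsE)
  have ws: "w = val (i # p @ q)" using pq(2) 2(4,2) by (metis 2(5) s_cancel(1) word_val_Cons)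
  have len: "length (i # p @ q) = len w"
    using pq(1) vs' by (metis add_Suc_right length_Cons length_append)
  have red: "red w (i # p @ q)" using ws len pqI 2 by (simp add: reduced_expr_def)
  from pq(1) consider us where "p = ?v @ us" | us where "?v = p @ a # us" "q = us @ vs"
    by (auto simp: append_eq_append_conv2 Cons_eq_append_conv append_eq_Cons_conv)
  then show ?case
  proof cases
    case 1
    then show ?thesis using red by auto
  next
    case (2 us)
    have l: "length (p @ us) + 2 = Suc k" using 2 length_alt_word[of j i k] by simp
    have I: "p @ us \<in> lists I" "vs \<in> lists I" "?v \<in> lists I" using pqI vs' 2 by auto
    have "val (?v @ vs) = val (i # (p @ us) @ vs)" using ws vs' 2 by simp
    then have "val ?v \<otimes> val vs = s i \<otimes> val (p @ us) \<otimes> val vs"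
      using I \<open>i \<in> I\<close> by (simp add: m_assoc del: append_assoc)
    then have "val ?v = s i \<otimes> val (p @ us)" using I \<open>i \<in> I\<close> by simp
    then have "s i \<otimes> val ?v = val (p @ us)" using I \<open>i \<in> I\<close> by simp
    then have "len (val (alt_word i j (Suc k))) \<le> length (p @ us)" using len_le[OF I(1)] by simp
    moreover have "len (val (alt_word i j (Suc k))) = Suc k"
      using redD(3)[OF red_alt_word] "2.prems" length_alt_word by metis
    ultimately show ?thesis using l by simp
  qed
qed

text \<open>
  For \<open>m(i,j) = \<infinity>\<close> the alternating prefixes of a word for \<open>w\<close> would be arbitrarily long.
\<close>

lemma cox_m_pos:
  assumes ij: "i \<in> I" "j \<in> I" "i \<noteq> j" and w: "w \<in> carrier W"
    and desc: "len (s i \<otimes> w) < len w" "len (s j \<otimes> w) < len w"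
  shows "cox_m W s i j > 0"
proof (rule ccontr)
  assume "\<not> ?thesis"
  then obtain vs where "red w (alt_word i j (Suc (len w)) @ vs)"
    using red_alt_prefix[OF assms, of "Suc (len w)"] by auto
  from redD(3)[OF this] show False by simp
qed

text \<open>
  Induction on the length. If the first letters \<open>i\<close> and \<open>j\<close> differ, both are descents of \<open>w\<close>, so
  \<open>w\<close> has reduced words beginning with the two sides of the braid relation of \<open>i\<close> and \<open>j\<close>. These
  share their first letter with \<open>us\<close> and \<open>vs\<close> respectively and agree with each other by the
  braid relation.
\<close>

lemma matsumoto:
  fixes M :: "('c, 'd) monoid_scheme"
  assumes M: "Group.monoid M" and f: "f ` I \<subseteq> carrier M"
    and braid: "\<And>i j. i \<in> I \<Longrightarrow> j \<in> I \<Longrightarrow>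
      word_val M f (alt_word i j (cox_m W s i j)) = word_val M f (alt_word j i (cox_m W s i j))"
    and "red w us" "red w vs"
  shows "word_val M f us = word_val M f vs"
  using assms(4,5)
proof (induction "length us" arbitrary: w us vs)
  case 0
  then show ?case by (auto simp: reduced_expr_def)
next
  case (Suc n)
  interpret M: Group.monoid M by (rule M)
  obtain i us' where us: "us = i # us'" using Suc(2) by (cases us) auto
  have "length vs = length us" using Suc by (auto simp: reduced_expr_def)
  then obtain j vs' where vs: "vs = j # vs'" using Suc(2) by (cases vs) auto
  have lensI: "length us' = n" "length vs' = n" using us vs Suc(2) \<open>length vs = length us\<close> by auto
  note ru = red_Cons[OF Suc(3)[unfolded us]] and rv = red_Cons[OF Suc(4)[unfolded vs]]
  have cl: "word_val M f ws \<in> carrier M" if "ws \<in> lists I" for ws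
    using that f by (intro M.word_val_closed) auto
  show ?case
  proof (cases "i = j")
    case True
    then have "val us' = val vs'"
      using ru rv redD(1)[OF ru(2)] redD(1)[OF rv(2)] by (metis s_cancel(1) val_closed)
    then show ?thesis using Suc(1)[of us' "val us'" vs'] ru rv lensI us vs True by simp
  next
    case False
    have w: "w \<in> carrier W" using redD(1,2)[OF Suc(3)] val_closed by metis
    have "s i \<otimes> w = val us'" "s j \<otimes> w = val vs'"
      using ru(1,3) rv(1,3) redD(1)[OF ru(2)] redD(1)[OF rv(2)] s_cancel(1) val_closed by metis+
    then have desc: "len (s i \<otimes> w) < len w" "len (s j \<otimes> w) < len w" using ru rv by auto
    let ?m = "cox_m W s i j"
    have "?m > 0" using cox_m_pos ru(1) rv(1) False w desc by blast
    then obtain m where m: "?m = Suc m" using gr0_conv_Suc by blast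
    obtain xs where xs: "red w (alt_word i j ?m @ xs)"
      using red_alt_prefix[OF ru(1) rv(1) False w desc, of ?m] by auto
    have xsI: "xs \<in> lists I" using redD(1)[OF xs] by simp
    have ys: "red w (alt_word j i ?m @ xs)"
      using redD[OF xs] xsI val_alt_word_m[OF ru(1) rv(1)]
        alt_word_closed[OF rv(1) ru(1)] alt_word_closed[OF ru(1) rv(1)]
      by (simp add: reduced_expr_def)
    have step: "word_val M f (a # ws) = word_val M f (a # zs)"
      if "red w (a # ws)" "red w (a # zs)" "length ws = n" for a ws zs
    proof -
      note r = red_Cons[OF that(1)] red_Cons[OF that(2)]
      have "val ws = val zs"
        using r redD(1)[OF r(2)] redD(1)[OF r(7)] by (metis s_cancel(1) val_closed)
      then show ?thesis using Suc(1)[of ws "val ws" zs] r that by simp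
    qed
    have "word_val M f us = word_val M f (alt_word i j ?m @ xs)"
      unfolding us m using step[of i us' "alt_word j i m @ xs"] Suc(3) xs m us lensI by simp
    also have "\<dots> = word_val M f (alt_word j i ?m @ xs)"
      using braid[OF ru(1) rv(1)] f xsI alt_word_closed[OF rv(1) ru(1)]
        alt_word_closed[OF ru(1) rv(1)]
      by (subst (1 2) M.word_val_append) (auto simp: image_subset_iff in_lists_conv_set)
    also have "\<dots> = word_val M f vs"
      unfolding vs m using step[of j vs' "alt_word i j m @ xs"] Suc(4) ys m vs lensI by simp
    finally show ?thesis .
  qed
qed

text \<open>
  With idempotent generators also non-reduced words can be evaluated: a letter that does not
  lengthen the Demazure product is the first letter of some reduced word of it, and is absorbed
  there.
\<close>

lemma word_val_dem:
  fixes M :: "('c, 'd) monoid_scheme"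
  assumes M: "Group.monoid M" and f: "f ` I \<subseteq> carrier M"
    and braid: "\<And>i j. i \<in> I \<Longrightarrow> j \<in> I \<Longrightarrow>
      word_val M f (alt_word i j (cox_m W s i j)) = word_val M f (alt_word j i (cox_m W s i j))"
    and idem: "\<And>i. i \<in> I \<Longrightarrow> f i \<otimes>\<^bsub>M\<^esub> f i = f i"
    and ws: "ws \<in> lists I" and vs: "red (dem ws) vs"
  shows "word_val M f ws = word_val M f vs"
  using ws vs
proof (induction ws arbitrary: vs)
  case Nil
  then show ?case by (auto simp: reduced_expr_def)
next
  case (Cons i ws)
  interpret M: Group.monoid M by (rule M)
  have cl: "word_val M f ws \<in> carrier M" if "ws \<in> lists I" for ws
    using that f by (intro M.word_val_closed) auto
  let ?x = "dem ws"
  have x: "?x \<in> carrier W" using Cons.hyps by simp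
  then obtain us where us: "red ?x us" using red_exists by metis
  have IH: "word_val M f ws = word_val M f us" using Cons.IH us by simp
  have fi: "f i \<in> carrier M" using Cons.hyps f by auto
  show ?case
  proof (cases "len ?x < len (s i \<otimes> ?x)")
    case True
    then have "red (dem (i # ws)) (i # us)"
      using red_ConsI[OF us] Cons.hyps by (simp add: ldem_def)
    from matsumoto[OF M f braid this Cons.prems] show ?thesis using IH by simp
  next
    case False
    have y: "s i \<otimes> ?x \<in> carrier W" using x Cons.hyps by simp
    then obtain ys where ys: "red (s i \<otimes> ?x) ys" using red_exists by metis
    have "red ?x (i # ys)"
      using red_ConsI[OF ys, of i] False x Cons.hyps len_s_mult[of i ?x] by auto
    moreover have "red ?x vs" using Cons.prems False by (simp add: ldem_def)
    ultimately have "word_val M f (i # ys) = word_val M f us"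
      "word_val M f (i # ys) = word_val M f vs"
      using matsumoto[OF M f braid] us by blast+
    then show ?thesis
      using IH idem[OF Cons.hyps(1)] cl[OF redD(1)[OF ys]] fi M.m_assoc
      by (metis M.word_val_Cons)
  qed
qed

end

section \<open>The basis elements of the 0-Hecke algebra\<close>

definition monomial :: "rat \<Rightarrow> 'i list \<Rightarrow> 'i list \<Rightarrow> rat" where
  "monomial c u = (\<lambda>w. if w = u then c else 0)"

text \<open>
  The linear extension to the free algebra of a function \<open>c\<close> on words. The sum is finite for \<open>f\<close>
  in the free algebra.
\<close>

definition pairing :: "('i list \<Rightarrow> rat) \<Rightarrow> ('i list \<Rightarrow> rat) \<Rightarrow> rat" where
  "pairing c f = (\<Sum>w | f w \<noteq> 0. c w * f w)"

lemma monomial_closed: "u \<in> lists I \<Longrightarrow> monomial c u \<in> carrier (free_alg I)"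
  by (auto simp: monomial_def free_alg_def)

lemma monomial_mult: "monomial c u \<otimes>\<^bsub>free_alg I\<^esub> monomial d v = monomial (c * d) (u @ v)"
proof
  fix w :: "'a list"
  have "(monomial c u \<otimes>\<^bsub>free_alg I\<^esub> monomial d v) w =
      (\<Sum>k\<le>length w. if k = length u then if w = u @ v then c * d else 0 else 0)"
    unfolding free_alg_def monomial_def monoid.simps ring.simps
  proof (rule sum.cong)
    fix k assume k: "k \<in> {..length w}"
    have "take k w = u \<and> drop k w = v \<longleftrightarrow> k = length u \<and> w = u @ v"
      using k by auto
    then show "(if take k w = u then c else 0) * (if drop k w = v then d else 0) =
        (if k = length u then if w = u @ v then c * d else 0 else 0)"
      by (cases "take k w = u"; cases "drop k w = v") auto
  qed simp
  also have "\<dots> = monomial (c * d) (u @ v) w"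
    by (auto simp: monomial_def)
  finally show "(monomial c u \<otimes>\<^bsub>free_alg I\<^esub> monomial d v) w = monomial (c * d) (u @ v) w" .
qed

lemma free_alg_minus:
  assumes "f \<in> carrier (free_alg I)"
  shows "\<ominus>\<^bsub>free_alg I\<^esub> f = (\<lambda>w. - f w)"
proof -
  interpret A: ring "free_alg I" by (rule ring_free_alg)
  show ?thesis
    using assms by (intro A.minus_equality) (auto simp: free_alg_def)
qed

lemma word_val_monomial:
  "word_val (free_alg I) (\<lambda>i. monomial c [i]) ws = monomial (c ^ length ws) ws"
proof -
  interpret A: ring "free_alg I" by (rule ring_free_alg)
  show ?thesis
  proof (induction ws)
    case Nil
    have "word_val (free_alg I) (\<lambda>i. monomial c [i]) [] = \<one>\<^bsub>free_alg I\<^esub>" by simp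
    then show ?case by (simp add: monomial_def free_alg_def)
  qed (simp add: monomial_mult)
qed

lemma pairing_superset:
  assumes "finite B" "{w. f w \<noteq> 0} \<subseteq> B"
  shows "pairing c f = (\<Sum>w \<in> B. c w * f w)"
  unfolding pairing_def using assms by (intro sum.mono_neutral_left) auto

lemma pairing_monomial: "pairing c (monomial d u) = c u * d"
  by (subst pairing_superset[of "{u}"]) (auto simp: monomial_def)

lemma pairing_add:
  assumes "f \<in> carrier (free_alg I)" "g \<in> carrier (free_alg I)"
  shows "pairing c (f \<oplus>\<^bsub>free_alg I\<^esub> g) = pairing c f + pairing c g"
proof -
  let ?B = "{w. f w \<noteq> 0} \<union> {w. g w \<noteq> 0}"
  have fB: "finite ?B" using assms by (simp add: free_alg_def)
  have "{w. (f \<oplus>\<^bsub>free_alg I\<^esub> g) w \<noteq> 0} \<subseteq> ?B" by (auto simp: free_alg_def)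
  then show ?thesis
    using pairing_superset[OF fB, of f] pairing_superset[OF fB, of g]
      pairing_superset[OF fB, of "f \<oplus>\<^bsub>free_alg I\<^esub> g"]
    by (simp add: free_alg_def ring_distribs sum.distrib)
qed

lemma pairing_uminus: "pairing c (\<lambda>w. - f w) = - pairing c f"
  by (simp add: pairing_def sum_negf)

lemma pairing_minus:
  assumes "f \<in> carrier (free_alg I)" "g \<in> carrier (free_alg I)"
  shows "pairing c (f \<ominus>\<^bsub>free_alg I\<^esub> g) = pairing c f - pairing c g"
proof -
  interpret A: ring "free_alg I" by (rule ring_free_alg)
  have "pairing c (f \<ominus>\<^bsub>free_alg I\<^esub> g) = pairing c f + pairing c (\<ominus>\<^bsub>free_alg I\<^esub> g)"
    unfolding A.minus_eq using assms by (intro pairing_add A.a_inv_closed)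
  then show ?thesis using assms(2) by (simp add: free_alg_minus pairing_uminus)
qed

lemma pairing_mult:
  assumes f: "f \<in> carrier (free_alg I)" and g: "g \<in> carrier (free_alg I)"
  shows "pairing c (f \<otimes>\<^bsub>free_alg I\<^esub> g) =
    (\<Sum>u | f u \<noteq> 0. \<Sum>v | g v \<noteq> 0. c (u @ v) * f u * g v)"
proof -
  let ?F = "{w. f w \<noteq> 0}" and ?G = "{w. g w \<noteq> 0}"
  define B where "B = (\<lambda>(u, v). u @ v) ` (?F \<times> ?G)"
  have fin: "finite ?F" "finite ?G" using f g by (auto simp: free_alg_def)
  then have B: "finite B" unfolding B_def by blast
  have mem: "u @ v \<in> B" if "f u \<noteq> 0" "g v \<noteq> 0" for u v
    unfolding B_def using that by force
  have sub: "{w. (f \<otimes>\<^bsub>free_alg I\<^esub> g) w \<noteq> 0} \<subseteq> B"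
  proof
    fix w assume "w \<in> {w. (f \<otimes>\<^bsub>free_alg I\<^esub> g) w \<noteq> 0}"
    then have "(\<Sum>k\<le>length w. f (take k w) * g (drop k w)) \<noteq> 0"
      by (simp add: free_alg_def)
    then obtain k where "f (take k w) * g (drop k w) \<noteq> 0"
      by (rule sum.not_neutral_contains_not_neutral)
    then show "w \<in> B" using mem[of "take k w" "drop k w"] by simp
  qed
  have "pairing c (f \<otimes>\<^bsub>free_alg I\<^esub> g) = (\<Sum>w \<in> B. c w * (f \<otimes>\<^bsub>free_alg I\<^esub> g) w)"
    by (rule pairing_superset[OF B sub])
  also have "\<dots> = (\<Sum>w \<in> B. \<Sum>k\<le>length w. c w * f (take k w) * g (drop k w))"
    by (simp add: free_alg_def sum_distrib_left mult.assoc)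
  also have "\<dots> = (\<Sum>(w, k) \<in> Sigma B (\<lambda>w. {..length w}). c w * f (take k w) * g (drop k w))"
    by (rule sum.Sigma) (use B in auto)
  also have "\<dots> = (\<Sum>(u, v) \<in> ?F \<times> ?G. c (u @ v) * f u * g v)"
  proof (rule sum.reindex_bij_witness_not_neutral[where
        S' = "{(w, k) \<in> Sigma B (\<lambda>w. {..length w}). f (take k w) * g (drop k w) = 0}"
        and T' = "{}" and i = "\<lambda>(u, v). (u @ v, length u)" and j = "\<lambda>(w, k). (take k w, drop k w)"])
    show "finite {(w, k) \<in> Sigma B (\<lambda>w. {..length w}). f (take k w) * g (drop k w) = 0}"
      by (rule finite_subset[OF _ finite_SigmaI[OF B, of "\<lambda>w. {..length w}"]]) auto
  qed (auto simp: mem)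
  also have "\<dots> = (\<Sum>u | f u \<noteq> 0. \<Sum>v | g v \<noteq> 0. c (u @ v) * f u * g v)"
    by (rule sum.Sigma[symmetric]) (use fin in auto)
  finally show ?thesis .
qed

context coxeter_system
begin

abbreviation A where "A \<equiv> free_alg I"
abbreviation H where "H \<equiv> hecke0 W I s"

text \<open>
  The kernel of the linear map from the free algebra to the monoid algebra of \<open>(W, \<star>)\<close> that
  sends a word to its Demazure product with the sign \<open>(- 1)\<^sup>k\<close>, where \<open>k\<close> is the length of the
  word. The sign makes \<open>T' = - T\<close>, and not \<open>T\<close>, correspond to the simple reflections. The kernel
  is described by coordinate functions \<open>c\<close> on \<open>W\<close>, so that the monoid algebra itself is not
  constructed.
\<close>

definition dem_null :: "('i list \<Rightarrow> rat) set" where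
  "dem_null = {f \<in> carrier A. \<forall>c. pairing (\<lambda>w. (- 1) ^ length w * c (dem w)) f = 0}"

text \<open>
  For a fixed word \<open>u\<close>, the map \<open>v \<mapsto> c (dem (u @ v))\<close> depends on \<open>v\<close> only through \<open>dem v\<close>, so it
  is a coordinate function of the same kind; the same holds with the sides exchanged.
\<close>

lemma ideal_dem_null: "ideal dem_null A"
proof -
  interpret A: ring A by (rule ring_free_alg)
  have supp: "u \<in> lists I" if "f \<in> carrier A" "f u \<noteq> 0" for f u
    using that by (auto simp: free_alg_def)
  show ?thesis
  proof (rule idealI)
    show "ring A" by (rule ring_free_alg)
    show "subgroup dem_null (add_monoid A)"
    proof (rule A.add.subgroupI)
      have "\<zero>\<^bsub>A\<^esub> \<in> dem_null"
        using A.zero_closed by (simp add: dem_null_def pairing_def) (simp add: free_alg_def)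
      then show "dem_null \<noteq> {}" by auto
      show "\<ominus>\<^bsub>A\<^esub> f \<in> dem_null" if "f \<in> dem_null" for f
        using that A.a_inv_closed[of f] by (simp add: dem_null_def free_alg_minus pairing_uminus)
    qed (auto simp: dem_null_def pairing_add)
  next
    fix f g assume f: "f \<in> dem_null" and g: "g \<in> carrier A"
    then have fA: "f \<in> carrier A" by (simp add: dem_null_def)
    have null: "pairing (\<lambda>w. (- 1) ^ length w * c (dem w)) f = 0" for c
      using f by (simp add: dem_null_def)
    have "pairing (\<lambda>w. (- 1) ^ length w * c (dem w)) (g \<otimes>\<^bsub>A\<^esub> f) = 0" for c
    proof -
      have "pairing (\<lambda>w. (- 1) ^ length w * c (dem w)) (g \<otimes>\<^bsub>A\<^esub> f) =
        (\<Sum>u | g u \<noteq> 0. \<Sum>v | f v \<noteq> 0.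
          (- 1) ^ length u * g u * ((- 1) ^ length v * c (dem u \<star> dem v) * f v))"
        unfolding pairing_mult[OF g fA]
        by (intro sum.cong HOL.refl) (simp add: dem_append supp[OF g] supp[OF fA] power_add)
      also have "\<dots> = (\<Sum>u | g u \<noteq> 0. (- 1) ^ length u * g u *
          pairing (\<lambda>w. (- 1) ^ length w * c (dem u \<star> dem w)) f)"
        by (simp only: sum_distrib_left pairing_def)
      finally show ?thesis using null[of "\<lambda>x. c (dem u \<star> x)" for u]
        by (simp only: mult_zero_right sum.neutral_const)
    qed
    then show "g \<otimes>\<^bsub>A\<^esub> f \<in> dem_null" using g fA by (simp add: dem_null_def)
    have "pairing (\<lambda>w. (- 1) ^ length w * c (dem w)) (f \<otimes>\<^bsub>A\<^esub> g) = 0" for c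
    proof -
      have "pairing (\<lambda>w. (- 1) ^ length w * c (dem w)) (f \<otimes>\<^bsub>A\<^esub> g) =
        (\<Sum>v | g v \<noteq> 0. \<Sum>u | f u \<noteq> 0.
          (- 1) ^ length v * g v * ((- 1) ^ length u * c (dem u \<star> dem v) * f u))"
        unfolding pairing_mult[OF fA g] sum.swap[of _ "{u. f u \<noteq> 0}"]
        by (intro sum.cong HOL.refl) (simp add: dem_append supp[OF g] supp[OF fA] power_add)
      also have "\<dots> = (\<Sum>v | g v \<noteq> 0. (- 1) ^ length v * g v *
          pairing (\<lambda>w. (- 1) ^ length w * c (dem w \<star> dem v)) f)"
        by (simp only: sum_distrib_left pairing_def)
      finally show ?thesis using null[of "\<lambda>x. c (x \<star> dem v)" for v]
        by (simp only: mult_zero_right sum.neutral_const)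
    qed
    then show "f \<otimes>\<^bsub>A\<^esub> g \<in> dem_null" using g fA by (simp add: dem_null_def)
  qed
qed

lemma word_elt_monomial: "word_elt u = monomial 1 u"
  by (simp add: word_elt_def monomial_def)

lemma hecke_ideal_dem_null: "hecke_ideal W I s \<subseteq> dem_null"
proof -
  interpret A: ring A by (rule ring_free_alg)
  have cl: "monomial 1 u \<in> carrier A" if "u \<in> lists I" for u
    using that by (rule monomial_closed)
  have "r \<in> dem_null" if r: "r \<in> hecke_relators W I s" for r
  proof -
    have rA: "r \<in> carrier A" using r hecke_relators_closed by blast
    from r consider i where "i \<in> I" "r = word_elt [i, i] \<oplus>\<^bsub>A\<^esub> word_elt [i]"
      | i j where "i \<in> I" "j \<in> I" "r = word_elt (alt_word i j (cox_m W s i j))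
          \<ominus>\<^bsub>A\<^esub> word_elt (alt_word j i (cox_m W s i j))"
      unfolding hecke_relators_def by blast
    then show ?thesis
    proof cases
      case 1
      have "ldem i (s i) = s i" using 1 by (simp add: ldem_def refl_square)
      then show ?thesis
        using 1 rA cl[of "[i, i]"] cl[of "[i]"]
        by (auto simp: dem_null_def word_elt_monomial pairing_add pairing_monomial)
    next
      case 2
      then show ?thesis
        using rA cl[OF alt_word_closed[OF 2(1,2)]] cl[OF alt_word_closed[OF 2(2,1)]]
          dem_alt_word_m[OF 2(1,2)]
        by (auto simp: dem_null_def word_elt_monomial pairing_minus pairing_monomial)
    qed
  qed
  then show ?thesis
    unfolding hecke_ideal_def by (intro A.genideal_minimal ideal_dem_null) auto
qed

abbreviation cls where "cls f \<equiv> hecke_ideal W I s +>\<^bsub>A\<^esub> f"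

lemma cls_eqI:
  assumes "f \<in> carrier A" "g \<in> carrier A" "f \<ominus>\<^bsub>A\<^esub> g \<in> hecke_ideal W I s"
  shows "cls f = cls g"
  using ring.quotient_eq_iff_same_a_r_cos[OF ring_free_alg
      ideal_hecke_ideal[where W = W and s = s] assms(1,2)] assms(3)
  by simp

text \<open>
  On words the generators \<open>T'\<close> contribute only a sign, so the value of a word is the class of a
  single monomial.
\<close>

lemma hecke_word:
  assumes "ws \<in> lists I"
  shows "word_val H (hecke_T'_gen W I s) ws = cls (monomial ((- 1) ^ length ws) ws)"
proof -
  interpret A: ring A by (rule ring_free_alg)
  interpret H: ring H by (rule ring_hecke0)
  interpret h: ring_hom_ring A H "\<lambda>f. cls f"
    unfolding hecke0_def by (rule ideal.rcos_ring_hom_ring[OF ideal_hecke_ideal])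
  have gen: "hecke_T'_gen W I s i = cls (monomial (- 1) [i])" if "i \<in> I" for i
  proof -
    have w: "word_elt [i] \<in> carrier A" using that by (simp add: word_elt_closed)
    have "hecke_T'_gen W I s i = cls (\<ominus>\<^bsub>A\<^esub> word_elt [i])"
      unfolding hecke_T'_gen_def hecke_T_def using w by simp
    also have "\<ominus>\<^bsub>A\<^esub> word_elt [i] = monomial (- 1) [i]"
      unfolding free_alg_minus[OF w] by (auto simp: word_elt_def monomial_def)
    finally show ?thesis .
  qed
  have "word_val H (hecke_T'_gen W I s) ws = cls (word_val A (\<lambda>i. monomial (- 1) [i]) ws)"
    using assms
  proof (induction ws)
    case (Cons i ws)
    have "monomial (- 1) [i] \<in> carrier A" using Cons.hyps by (simp add: monomial_closed)
    moreover have "word_val A (\<lambda>i. monomial (- 1) [i]) ws \<in> carrier A"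
      using Cons.hyps by (simp add: word_val_monomial monomial_closed)
    ultimately show ?case using Cons by (simp add: gen)
  qed simp
  then show ?thesis by (simp add: word_val_monomial)
qed

lemma hecke_T'_gen_closed: "hecke_T'_gen W I s ` I \<subseteq> carrier H"
proof -
  interpret H: ring H by (rule ring_hecke0)
  interpret h: ring_hom_ring A H "\<lambda>f. cls f"
    unfolding hecke0_def by (rule ideal.rcos_ring_hom_ring[OF ideal_hecke_ideal])
  show ?thesis
    using word_elt_closed[of "[_]" I] by (auto simp: hecke_T'_gen_def hecke_T_def)
qed

lemma hecke_T'_word:
  assumes ws: "ws \<in> lists I"
  shows "word_val H (hecke_T'_gen W I s) ws = hecke_T' W I s (dem ws)"
  unfolding hecke_T'_def
proof (rule word_val_dem)
  interpret A: ring A by (rule ring_free_alg)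
  interpret H: ring H by (rule ring_hecke0)
  interpret J: ideal "hecke_ideal W I s" A by (rule ideal_hecke_ideal)
  show "Group.monoid H" by (rule H.monoid_axioms)
  show "hecke_T'_gen W I s ` I \<subseteq> carrier H" by (rule hecke_T'_gen_closed)
  have rel: "r \<in> hecke_ideal W I s" if "r \<in> hecke_relators W I s" for r
    unfolding hecke_ideal_def using A.genideal_self[OF hecke_relators_closed] that by blast
  show "word_val H (hecke_T'_gen W I s) (alt_word i j (cox_m W s i j)) =
      word_val H (hecke_T'_gen W I s) (alt_word j i (cox_m W s i j))" if ij: "i \<in> I" "j \<in> I" for i j
  proof -
    let ?m = "cox_m W s i j"
    let ?u = "alt_word i j ?m" and ?v = "alt_word j i ?m"
    have uv: "?u \<in> lists I" "?v \<in> lists I" using ij by (simp_all add: alt_word_closed)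
    have cl: "word_elt ?u \<in> carrier A" "word_elt ?v \<in> carrier A"
      using uv by (simp_all add: word_elt_closed)
    have "word_elt ?u \<ominus>\<^bsub>A\<^esub> word_elt ?v \<in> hecke_ideal W I s"
      by (rule rel) (use ij in \<open>auto simp: hecke_relators_def\<close>)
    then have "monomial ((- 1) ^ ?m) [] \<otimes>\<^bsub>A\<^esub> (word_elt ?u \<ominus>\<^bsub>A\<^esub> word_elt ?v) \<in> hecke_ideal W I s"
      by (rule J.I_l_closed) (simp add: monomial_closed)
    also have "monomial ((- 1) ^ ?m) [] \<otimes>\<^bsub>A\<^esub> (word_elt ?u \<ominus>\<^bsub>A\<^esub> word_elt ?v) =
        monomial ((- 1) ^ ?m) ?u \<ominus>\<^bsub>A\<^esub> monomial ((- 1) ^ ?m) ?v"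
      using cl monomial_closed[of "[]" I "(- 1) ^ ?m"]
      by (simp add: A.minus_eq A.r_distr A.r_minus) (simp add: word_elt_monomial monomial_mult)
    finally show ?thesis
      using cls_eqI uv by (simp add: hecke_word monomial_closed)
  qed
  show "hecke_T'_gen W I s i \<otimes>\<^bsub>H\<^esub> hecke_T'_gen W I s i = hecke_T'_gen W I s i" if i: "i \<in> I" for i
  proof -
    have T: "hecke_T'_gen W I s i \<in> carrier H" using hecke_T'_gen_closed i by auto
    have ii: "[i, i] \<in> lists I" "[i] \<in> lists I" using i by auto
    have "word_elt [i, i] \<oplus>\<^bsub>A\<^esub> word_elt [i] \<in> hecke_ideal W I s"
      by (rule rel) (use i in \<open>auto simp: hecke_relators_def\<close>)
    also have "word_elt [i, i] \<oplus>\<^bsub>A\<^esub> word_elt [i] = monomial 1 [i, i] \<ominus>\<^bsub>A\<^esub> monomial (- 1) [i]"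
    proof -
      have "\<ominus>\<^bsub>A\<^esub> monomial (- 1) [i] = monomial 1 [i]"
        unfolding free_alg_minus[OF monomial_closed[OF ii(2)]] by (auto simp: monomial_def)
      then show ?thesis by (simp add: A.minus_eq word_elt_monomial)
    qed
    finally have "cls (monomial 1 [i, i]) = cls (monomial (- 1) [i])"
      using ii by (intro cls_eqI monomial_closed)
    then show ?thesis
      using hecke_word[OF ii(1)] hecke_word[OF ii(2)] T by simp
  qed
  show "ws \<in> lists I" by (rule ws)
  show "red (dem ws) (SOME vs. red (dem ws) vs)"
    using red_exists[OF dem_closed[OF ws]] by (rule someI_ex)
qed

lemma hecke_T'_mult:
  assumes "x \<in> carrier W" "y \<in> carrier W"
  shows "hecke_T' W I s x \<otimes>\<^bsub>H\<^esub> hecke_T' W I s y = hecke_T' W I s (x \<star> y)"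
proof -
  interpret H: ring H by (rule ring_hecke0)
  obtain us vs where uv: "us \<in> lists I" "vs \<in> lists I" "x = dem us" "y = dem vs"
    using assms dem_surj by metis
  have "word_val H (hecke_T'_gen W I s) (us @ vs) =
      word_val H (hecke_T'_gen W I s) us \<otimes>\<^bsub>H\<^esub> word_val H (hecke_T'_gen W I s) vs"
    by (rule H.word_val_append) (use uv hecke_T'_gen_closed in auto)
  then show ?thesis using uv hecke_T'_word[of "us @ vs"] by (simp add: hecke_T'_word dem_append)
qed

text \<open>
  The defining ideal lies in the kernel \<open>dem_null\<close>, so the Demazure product of a word is
  determined by the class of its signed monomial.
\<close>

lemma hecke_T'_inj:
  assumes "x \<in> carrier W" "y \<in> carrier W" "hecke_T' W I s x = hecke_T' W I s y"
  shows "x = y"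
proof -
  interpret A: ring A by (rule ring_free_alg)
  obtain us vs where uv: "us \<in> lists I" "vs \<in> lists I" "x = dem us" "y = dem vs"
    using assms dem_surj by metis
  let ?u = "monomial ((- 1) ^ length us) us" and ?v = "monomial ((- 1) ^ length vs) vs"
  have cl: "?u \<in> carrier A" "?v \<in> carrier A" using uv by (simp_all add: monomial_closed)
  have "cls ?u = cls ?v" using assms(3) uv by (simp flip: hecke_T'_word add: hecke_word)
  then have "?u \<ominus>\<^bsub>A\<^esub> ?v \<in> dem_null"
    using A.quotient_eq_iff_same_a_r_cos[OF ideal_hecke_ideal cl] hecke_ideal_dem_null by blast
  then have null: "\<forall>c. pairing (\<lambda>w. (- 1) ^ length w * c (dem w)) (?u \<ominus>\<^bsub>A\<^esub> ?v) = 0"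
    by (simp add: dem_null_def)
  from spec[OF null, of "\<lambda>z. of_bool (z = x)"]
  have "of_bool (dem us = x) - of_bool (dem vs = x) = (0 :: rat)"
    by (simp add: pairing_minus[OF cl] pairing_monomial mult.assoc mult.commute flip: power_add)
  then show ?thesis using uv by (auto split: if_splits)
qed

lemma star_mult_eq:
  assumes "x \<in> carrier W" "y \<in> carrier W"
  shows "star_mult W I s x y = x \<star> y"
  unfolding star_mult_def using assms
  by (intro the_equality) (auto simp: hecke_T'_mult intro: hecke_T'_inj)

section \<open>Longest elements of parabolic subgroups\<close>

text \<open>
  An element with all descents in \<open>J\<close> on one side absorbs \<open>W\<^sub>J\<close> on that side. Two elements of
  \<open>W\<^sub>J\<close>, one with all left and one with all right descents, hence agree: each equals their
  product. The uniqueness of longest elements rests on this.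
\<close>

lemma dmult_absorb_left:
  assumes J: "J \<subseteq> I" and x: "x \<in> parab J" and y: "y \<in> carrier W"
    and desc: "\<And>i. i \<in> J \<Longrightarrow> ldem i y = y"
  shows "x \<star> y = y"
proof -
  obtain ws where ws: "ws \<in> lists J" "red x ws" using parab_red_exists[OF J x] by blast
  have "lact ws y = y" using ws(1) by (induction ws) (auto simp: desc)
  then show ?thesis using dmult_lact[OF redD(1)[OF ws(2)] dem_red[OF ws(2)] y] by simp
qed

lemma dmult_absorb_right:
  assumes J: "J \<subseteq> I" and x: "x \<in> carrier W" and y: "y \<in> parab J"
    and desc: "\<And>i. i \<in> J \<Longrightarrow> rdem i x = x"
  shows "x \<star> y = x"
proof -
  obtain ws where ws: "ws \<in> lists J" "red y ws" using parab_red_exists[OF J y] by blast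
  have "x \<star> dem ws = x" using ws(1)
  proof (induction ws)
    case (Cons i ws)
    have i: "i \<in> I" "dem ws \<in> carrier W"
      using Cons.hyps J lists_mono[OF J] dem_closed by blast+
    have "x \<star> dem (i # ws) = x \<star> s i \<star> dem ws" using i x by (simp add: dmult_assoc del: dmult_s)
    then show ?case using Cons i x desc by simp
  qed (use x in simp)
  then show ?thesis using dem_red[OF ws(2)] by simp
qed

lemma s_parab: "i \<in> J \<Longrightarrow> s i \<in> parab J"
  by (auto intro: generate.incl)

lemma parab_mult: "x \<in> parab J \<Longrightarrow> y \<in> parab J \<Longrightarrow> x \<otimes> y \<in> parab J"
  by (rule generate.eng)

lemma parab_inv: "J \<subseteq> I \<Longrightarrow> x \<in> parab J \<Longrightarrow> inv x \<in> parab J"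
  using parab_subgroup subgroup.m_inv_closed by metis

lemma s_in_parab:
  assumes J: "J \<subseteq> I" and i: "i \<in> I" and p: "s i \<in> parab J"
  shows "i \<in> J"
proof -
  obtain ws where ws: "ws \<in> lists J" "red (s i) ws" using parab_red_exists[OF J p] by blast
  then have "length ws = 1" using redD(3)[OF ws(2)] i by simp
  then obtain j where "ws = [j]" by (auto simp: length_Suc_conv)
  then have "j \<in> J" "s i = s j" using ws redD(2)[OF ws(2)] J by auto
  then show ?thesis using refl_inj i J by (metis inj_onD subsetD)
qed

lemma rdem_eq_self: "i \<in> I \<Longrightarrow> x \<in> carrier W \<Longrightarrow> rdem i x = x \<longleftrightarrow> len (x \<otimes> s i) < len x"
  using len_mult_s[of i x] by (auto simp: rdem_def dest: arg_cong[of _ _ len])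

lemma ex_right_descent:
  assumes "x \<in> carrier W" "x \<noteq> \<one>"
  shows "\<exists>i \<in> I. len (x \<otimes> s i) < len x"
proof -
  obtain ws where ws: "red (inv x) ws" using red_exists[of "inv x"] assms by auto
  have "len (inv x) \<noteq> 0" using assms by (simp add: len_eq_0)
  then obtain i vs where iv: "ws = i # vs" using redD(3)[OF ws] by (cases ws) auto
  note r = red_Cons[OF ws[unfolded iv]]
  have vs: "val vs \<in> carrier W" using val_closed[OF redD(1)[OF r(2)]] .
  have "x = inv (s i \<otimes> val vs)" using r(3) assms by (metis inv_inv)
  then have "x \<otimes> s i = inv (val vs)" using vs r(1) by (simp add: inv_mult_group)
  then show ?thesis using r(1,4) vs assms by (intro bexI[of _ i]) simp_all
qed

text \<open>
  If the length of \<open>a b\<close> dropped at some letter of a reduced word of \<open>a\<close>, the exchange condition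
  would shorten either that word or a reduced word of \<open>b\<close>. The second yields a shorter element
  of the coset \<open>W\<^sub>J b\<close>.
\<close>

lemma coset_min_additive:
  assumes J: "J \<subseteq> I" and b: "b \<in> carrier W" and min: "\<And>a. a \<in> parab J \<Longrightarrow> len b \<le> len (a \<otimes> b)"
    and a: "a \<in> parab J"
  shows "len (a \<otimes> b) = len a + len b"
proof -
  obtain ws where ws: "ws \<in> lists J" "red a ws" using parab_red_exists[OF J a] by blast
  then show ?thesis
  proof (induction ws arbitrary: a)
    case Nil
    then show ?case using b by (auto simp: reduced_expr_def)
  next
    case (Cons i ws)
    note r = red_Cons[OF Cons.prems]
    let ?c = "val ws"
    have i: "i \<in> J" "i \<in> I" using Cons.hyps J by auto
    have wsJ: "ws \<in> lists J" "ws \<in> lists I" using Cons.hyps redD(1)[OF r(2)] by auto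
    have c: "?c \<in> carrier W" "?c \<in> parab J" using wsJ parab_eq_val[OF J] by auto
    have IH: "len (?c \<otimes> b) = len ?c + len b" by (rule Cons.IH[OF r(2)])
    have "len (?c \<otimes> b) < len (s i \<otimes> (?c \<otimes> b))"
    proof (rule ccontr)
      assume neg: "\<not> ?thesis"
      obtain bs where bs: "red b bs" using red_exists[OF b] ..
      note bs' = redD[OF bs]
      have "val (ws @ bs) = ?c \<otimes> b" using bs' wsJ by simp
      then obtain p d q where pq: "ws @ bs = p @ d # q" "s i \<otimes> (?c \<otimes> b) = val (p @ q)"
        using exchange[of i "ws @ bs"] neg i bs' wsJ by auto
      have pqI: "p \<in> lists I" "q \<in> lists I" using pq(1) bs' wsJ
        by (metis append_in_lists_conv listsE)+
      from pq(1) consider us where "ws = p @ d # us" "q = us @ bs"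
        | us where "p = ws @ us" "bs = us @ d # q"
        by (auto simp: append_eq_append_conv2 Cons_eq_append_conv append_eq_Cons_conv)
      then show False
      proof cases
        case (1 us)
        have us: "us \<in> lists I" using 1 pqI by simp
        have "s i \<otimes> ?c \<otimes> b = val (p @ us) \<otimes> b" using pq(2) 1 us pqI bs' c b i by (simp add: m_assoc)
        then have "s i \<otimes> ?c = val (p @ us)"
          using us pqI c b i by (metis append_in_lists_conv m_closed right_cancel s_closed val_closed)
        then have "len a \<le> length (p @ us)" using len_le[of "p @ us"] r us pqI by simp
        then show False using r redD(3)[OF r(2)] 1 by simp
      next
        case (2 us)
        have us: "us \<in> lists I" using 2 pqI by simp
        \<comment> \<open>Deleting \<open>d\<close> from the reduced word of \<open>b\<close> amounts to multiplying \<open>b\<close> by this element of \<open>W\<^sub>J\<close>.\<close>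
        let ?a = "inv ?c \<otimes> s i \<otimes> ?c"
        have "?a \<in> parab J" using c i J by (intro parab_mult parab_inv s_parab)
        moreover have "?a \<otimes> b = val (us @ q)"
        proof -
          have "?a \<otimes> b = inv ?c \<otimes> (s i \<otimes> (?c \<otimes> b))" using c b i by (simp add: m_assoc)
          also have "\<dots> = inv ?c \<otimes> (?c \<otimes> val (us @ q))"
            using pq(2) 2 us pqI wsJ by (simp add: m_assoc)
          finally show ?thesis using c us pqI by (simp add: m_assoc[symmetric])
        qed
        ultimately have "len b \<le> length (us @ q)" using min len_le[of "us @ q"] us pqI by fastforce
        then show False using 2 bs' by simp
      qed
    qed
    then show ?case using len_s_mult[of i "?c \<otimes> b"] IH r c b i by (simp add: m_assoc)
  qed
qed

end

locale finite_coxeter_system = coxeter_system W I s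
  for W :: "('w, 'm) monoid_scheme" (structure) and I :: "'i set" and s :: "'i \<Rightarrow> 'w" +
  assumes finite_carrier: "finite (carrier W)"
begin

abbreviation longest where "longest J \<equiv> longest_elt W I s J"
abbreviation w0 where "w0 \<equiv> longest_elt W I s I"

lemma descents_unique:
  assumes "J \<subseteq> I" "x \<in> parab J" "y \<in> parab J"
    and "\<And>i. i \<in> J \<Longrightarrow> rdem i x = x" "\<And>i. i \<in> J \<Longrightarrow> ldem i y = y"
  shows "x = y"
  using dmult_absorb_left[of J x y] dmult_absorb_right[of J x y] assms parab_closed by metis

lemma maximal_descents:
  assumes J: "J \<subseteq> I" and w: "w \<in> parab J" and max: "\<And>v. v \<in> parab J \<Longrightarrow> len v \<le> len w"
    and i: "i \<in> J"
  shows "ldem i w = w" "rdem i w = w"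
  using max[of "s i \<otimes> w"] max[of "w \<otimes> s i"] parab_mult[OF s_parab[OF i] w]
    parab_mult[OF w s_parab[OF i]] by (auto simp: ldem_def rdem_def)

lemma longest_max:
  assumes J: "J \<subseteq> I"
  shows "longest J \<in> parab J \<and> (\<forall>v \<in> parab J. len v \<le> len (longest J))"
proof -
  let ?P = "\<lambda>w. w \<in> parab J \<and> (\<forall>v \<in> parab J. len v \<le> len w)"
  have fin: "finite (parab J)" using finite_subset[OF parab_subset[OF J] finite_carrier] .
  have ne: "parab J \<noteq> {}" using generate.one by auto
  obtain w where w: "w \<in> parab J" "len w = Max (len ` parab J)"
    using Max_in[of "len ` parab J"] fin ne by fastforce
  then have P: "?P w" using fin by simp
  moreover have "v = w" if "?P v" for v
    by (rule descents_unique[OF J]) (use that P maximal_descents[OF J] in auto)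
  ultimately have "\<exists>!w. ?P w" by blast
  then show ?thesis unfolding longest_elt_def by (rule theI')
qed

lemma longest_parab: "J \<subseteq> I \<Longrightarrow> longest J \<in> parab J"
  using longest_max by blast

lemma longest_closed [simp]: "J \<subseteq> I \<Longrightarrow> longest J \<in> carrier W"
  using longest_parab parab_closed by blast

lemma longest_desc:
  assumes "J \<subseteq> I" "i \<in> J"
  shows "ldem i (longest J) = longest J" "rdem i (longest J) = longest J"
  using maximal_descents[OF assms(1) longest_parab _ assms(2)] longest_max assms by blast+

lemma longest_eqI_left:
  "\<lbrakk>J \<subseteq> I; w \<in> parab J; \<And>i. i \<in> J \<Longrightarrow> ldem i w = w\<rbrakk> \<Longrightarrow> w = longest J"
  using descents_unique[of J "longest J" w] longest_parab longest_desc by simp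

lemma longest_eqI_right:
  "\<lbrakk>J \<subseteq> I; w \<in> parab J; \<And>i. i \<in> J \<Longrightarrow> rdem i w = w\<rbrakk> \<Longrightarrow> w = longest J"
  using descents_unique[of J w "longest J"] longest_parab longest_desc by simp

lemma longest_inv:
  assumes J: "J \<subseteq> I"
  shows "inv (longest J) = longest J"
proof (rule longest_eqI_right[OF J parab_inv[OF J longest_parab[OF J]]])
  fix i assume "i \<in> J"
  then show "rdem i (inv (longest J)) = inv (longest J)"
    using inv_ldem[of i "longest J"] longest_desc(1)[OF J] J by auto
qed

lemma longest_square:
  assumes "J \<subseteq> I"
  shows "longest J \<otimes> longest J = \<one>"
  using r_inv[of "longest J"] assms by (simp add: longest_inv)

lemma longest_cancel [simp]:
  assumes "J \<subseteq> I" "x \<in> carrier W"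
  shows "longest J \<otimes> (longest J \<otimes> x) = x" "x \<otimes> longest J \<otimes> longest J = x"
  using assms by (simp_all flip: m_assoc add: longest_square) (simp add: m_assoc longest_square)

text \<open>
  Shown as \<open>len y + len (y\<^sup>-\<^sup>1 w) = len w\<close>, where \<open>w\<close> is the longest element, by induction
  downwards on the length of \<open>y\<close>: an element of \<open>W\<^sub>J\<close> other than \<open>w\<close> can be lengthened on the
  right by some letter of \<open>J\<close>, and \<open>\<ge>\<close> is the triangle inequality.
\<close>

lemma len_mult_longest:
  assumes J: "J \<subseteq> I" and v: "v \<in> parab J"
  shows "len (v \<otimes> longest J) + len v = len (longest J)"
proof -
  have le: "len y \<le> len (longest J)" if "y \<in> parab J" for y
    using longest_max[OF J] that by blast
  have "len y + len (inv y \<otimes> longest J) = len (longest J)" if "y \<in> parab J" for y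
    using that
  proof (induction "len (longest J) - len y" arbitrary: y rule: less_induct)
    case less
    have y: "y \<in> carrier W" using less.prems parab_closed J by blast
    show ?case
    proof (cases "\<exists>i \<in> J. rdem i y \<noteq> y")
      case True
      then obtain i where i: "i \<in> J" "i \<in> I" and up: "len (y \<otimes> s i) = len y + 1"
        using J y len_mult_s by (fastforce simp: rdem_def)
      have yi: "y \<otimes> s i \<in> parab J" using less.prems i by (intro parab_mult s_parab)
      then have "len (y \<otimes> s i) + len (inv (y \<otimes> s i) \<otimes> longest J) = len (longest J)"
        using less.hyps[of "y \<otimes> s i"] up le[OF yi] by simp
      then have "len y + 1 + len (s i \<otimes> (inv y \<otimes> longest J)) = len (longest J)"
        using i y J up by (simp add: inv_mult_group m_assoc)
      moreover have "inv y \<otimes> longest J \<in> carrier W" using y J by simp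
      moreover have "len (longest J) \<le> len y + len (inv y \<otimes> longest J)"
        using len_mult_le[of y "inv y \<otimes> longest J"] y J by (simp add: m_assoc[symmetric])
      ultimately show ?thesis using len_s_mult[of i "inv y \<otimes> longest J"] i by auto
    next
      case False
      then have "y = longest J" using longest_eqI_right[OF J less.prems] by blast
      then show ?thesis using J by (simp add: longest_inv longest_square)
    qed
  qed
  from this[OF parab_inv[OF J v]] show ?thesis using parab_closed[OF J v] by (simp add: add.commute)
qed

lemma len_longest_mult:
  assumes J: "J \<subseteq> I" and v: "v \<in> parab J"
  shows "len (longest J \<otimes> v) + len v = len (longest J)"
  using len_mult_longest[OF J parab_inv[OF J v]] len_inv[of "longest J \<otimes> v"] J parab_closed[OF J v]
  by (simp add: inv_mult_group longest_inv)

text \<open>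
  The conjugate lies in \<open>W\<^sub>J\<close> and has length \<open>1\<close>, by two applications of the length formula.
\<close>

lemma longest_conj_s:
  assumes J: "J \<subseteq> I" and i: "i \<in> J"
  shows "\<exists>j \<in> J. longest J \<otimes> s i \<otimes> longest J = s j"
proof -
  let ?m = "longest J"
  have iI: "i \<in> I" using i J by blast
  have m: "?m \<in> parab J" "?m \<in> carrier W" using J longest_parab by auto
  have p: "?m \<otimes> s i \<in> parab J" using m i by (intro parab_mult s_parab)
  have "len (?m \<otimes> s i) + 1 = len ?m" using len_longest_mult[OF J s_parab[OF i]] iI by simp
  then have 1: "len (?m \<otimes> s i \<otimes> ?m) = 1" using len_mult_longest[OF J p] by simp
  then obtain j where j: "j \<in> I" "?m \<otimes> s i \<otimes> ?m = s j" using len_1 m iI by (meson m_closed s_closed)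
  moreover have "?m \<otimes> s i \<otimes> ?m \<in> parab J" using p m(1) by (rule parab_mult)
  ultimately show ?thesis using s_in_parab[OF J] by metis
qed

lemma rdem_longest_iff:
  assumes J: "J \<subseteq> I" and i: "i \<in> I"
  shows "rdem i (longest J) = longest J \<longleftrightarrow> i \<in> J"
proof
  assume "rdem i (longest J) = longest J"
  then have "len (longest J \<otimes> s i) < len (longest J)" using rdem_eq_self i J by simp
  then have le: "len (s i \<otimes> longest J) \<le> len (longest J)"
    using len_inv[of "longest J \<otimes> s i"] i J by (simp add: inv_mult_group longest_inv)
  obtain ws where ws: "ws \<in> lists J" "red (longest J) ws"
    using parab_red_exists[OF J longest_parab[OF J]] by blast
  then obtain p a q where pq: "ws = p @ a # q" "s i \<otimes> longest J = val (p @ q)"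
    using exchange[of i ws] i le redD[OF ws(2)] by auto
  then have "s i \<otimes> longest J \<in> parab J" using ws(1) parab_eq_val[OF J] by simp
  then have "s i \<otimes> longest J \<otimes> longest J \<in> parab J" using longest_parab[OF J] by (rule parab_mult)
  then show "i \<in> J" using s_in_parab[OF J i] J i by simp
qed (use longest_desc J in blast)

lemma longest_inj:
  assumes "J \<subseteq> I" "K \<subseteq> I" "longest J = longest K"
  shows "J = K"
  using rdem_longest_iff assms by (metis subsetD subset_antisym subsetI)

lemma parab_I: "parab I = carrier W"
  by (rule generated)

lemma len_mult_w0: "x \<in> carrier W \<Longrightarrow> len (x \<otimes> w0) + len x = len w0"
  using len_mult_longest[of I x] parab_I by simp

lemma len_w0_mult: "x \<in> carrier W \<Longrightarrow> len (w0 \<otimes> x) + len x = len w0"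
  using len_longest_mult[of I x] parab_I by simp

lemma w0_conj_s: "i \<in> I \<Longrightarrow> \<exists>j \<in> I. w0 \<otimes> s i \<otimes> w0 = s j"
  by (rule longest_conj_s) auto

section \<open>An anti-automorphism of the Demazure product\<close>

definition dual :: "'w \<Rightarrow> 'w" where
  "dual x = w0 \<otimes> inv x \<otimes> w0"

lemma dual_closed [simp]: "x \<in> carrier W \<Longrightarrow> dual x \<in> carrier W"
  by (simp add: dual_def)

lemma len_dual: "x \<in> carrier W \<Longrightarrow> len (dual x) = len x"
  using len_w0_mult[of "inv x"] len_mult_w0[of "w0 \<otimes> inv x"] by (simp add: dual_def)

lemma dual_one: "dual \<one> = \<one>"
  by (simp add: dual_def longest_square)

lemma dual_s: "i \<in> I \<Longrightarrow> \<exists>j \<in> I. dual (s i) = s j"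
  using w0_conj_s by (simp add: dual_def)

lemma dual_mult: "x \<in> carrier W \<Longrightarrow> y \<in> carrier W \<Longrightarrow> dual (x \<otimes> y) = dual y \<otimes> dual x"
  by (simp add: dual_def inv_mult_group m_assoc)

lemma dual_ldem:
  assumes i: "i \<in> I" and x: "x \<in> carrier W"
  shows "dual (ldem i x) = dual x \<star> dual (s i)"
proof -
  obtain j where j: "j \<in> I" "dual (s i) = s j" using dual_s[OF i] by blast
  have "dual (s i \<otimes> x) = dual x \<otimes> s j" using i x j by (simp add: dual_mult)
  moreover have "len (dual (s i \<otimes> x)) = len (s i \<otimes> x)" using i x by (simp add: len_dual)
  ultimately show ?thesis using i x j by (simp add: ldem_def rdem_def len_dual)
qed

lemma dual_dmult:
  assumes x: "x \<in> carrier W" and y: "y \<in> carrier W"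
  shows "dual (x \<star> y) = dual y \<star> dual x"
proof -
  have "dual (lact ws y) = dual y \<star> dual (dem ws)" if "ws \<in> lists I" for ws
    using that
  proof (induction ws)
    case (Cons i ws)
    then show ?case using y by (simp add: dual_ldem dmult_assoc)
  qed (use y in \<open>simp add: dual_one\<close>)
  then show ?thesis using dem_surj[OF x] dmult_lact y by metis
qed

section \<open>The commutative submonoid\<close>

text \<open>
  As \<open>w\<^sub>0\<^sup>J\<close> is an involution with \<open>w\<^sub>0\<^sup>I = w\<^sub>0\<^sup>J (w\<^sub>0\<^sup>J w\<^sub>0\<^sup>I)\<close> of additive length, this is the
  shortest representative of the coset \<open>W\<^sub>J w\<^sub>0\<^sup>I\<close>.
\<close>

definition coset_rep :: "'i set \<Rightarrow> 'w" where
  "coset_rep J = longest J \<otimes> w0"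

text \<open>
  An equational description of the elements \<open>w\<^sub>0\<^sup>J w\<^sub>0\<^sup>I\<close>, chosen because it is visibly
  preserved by \<open>\<star>\<close>.
\<close>

definition slides :: "'w \<Rightarrow> bool" where
  "slides x \<longleftrightarrow> x \<in> carrier W \<and> (\<forall>i \<in> I. x \<star> s i = x \<or> (\<exists>j \<in> I. x \<star> s i = s j \<star> x))"

lemma slides_dmult:
  assumes x: "slides x" and y: "slides y"
  shows "slides (x \<star> y)"
proof -
  have cl: "x \<in> carrier W" "y \<in> carrier W" using x y by (auto simp: slides_def)
  have "x \<star> y \<star> s i = x \<star> y \<or> (\<exists>j \<in> I. x \<star> y \<star> s i = s j \<star> (x \<star> y))" if i: "i \<in> I" for i
  proof -
    have assoc: "x \<star> y \<star> s i = x \<star> (y \<star> s i)" using cl i by (intro dmult_assoc) auto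
    consider "y \<star> s i = y" | j where "j \<in> I" "y \<star> s i = s j \<star> y"
      using y i by (auto simp: slides_def simp del: dmult_s s_dmult)
    then show ?thesis
    proof cases
      case 1
      then show ?thesis using assoc by simp
    next
      case (2 j)
      have "x \<star> y \<star> s i = x \<star> s j \<star> y"
        unfolding assoc 2(2) using cl 2(1) by (intro dmult_assoc[symmetric]) auto
      moreover have "x \<star> s j = x \<or> (\<exists>k \<in> I. x \<star> s j = s k \<star> x)"
        using x 2(1) by (auto simp: slides_def simp del: dmult_s s_dmult)
      ultimately show ?thesis using dmult_assoc cl s_closed by metis
    qed
  qed
  then show ?thesis using cl by (simp add: slides_def del: dmult_s s_dmult)
qed

text \<open>
  Let \<open>s\<^sub>k\<close> be the conjugate of \<open>s\<^sub>i\<close> by \<open>w\<^sub>0\<^sup>I\<close>. If \<open>k \<in> J\<close>, then \<open>w\<^sub>0\<^sup>J\<close> conjugates \<open>s\<^sub>k\<close> to a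
  simple reflection, which is the one that appears on the left. Otherwise \<open>s\<^sub>k\<close> lengthens
  \<open>w\<^sub>0\<^sup>J\<close>, so \<open>s\<^sub>i\<close> shortens \<open>w\<^sub>0\<^sup>J w\<^sub>0\<^sup>I\<close> and is absorbed.
\<close>

lemma slides_coset_rep:
  assumes J: "J \<subseteq> I"
  shows "slides (coset_rep J)"
proof -
  let ?m = "longest J" and ?x = "coset_rep J"
  have m: "?m \<in> carrier W" using J by simp
  have x: "?x \<in> carrier W" using m by (simp add: coset_rep_def)
  have "rdem i ?x = ?x \<or> (\<exists>j \<in> I. rdem i ?x = ldem j ?x)" if i: "i \<in> I" for i
  proof -
    obtain k where k: "k \<in> I" "w0 \<otimes> s i \<otimes> w0 = s k" using w0_conj_s[OF i] by blast
    have "w0 \<otimes> s i = s k \<otimes> w0"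
      using k i by (metis longest_cancel(2) longest_closed m_closed order_refl s_closed)
    then have xi: "?x \<otimes> s i = ?m \<otimes> s k \<otimes> w0" using m i k by (simp add: coset_rep_def m_assoc)
    show ?thesis
    proof (cases "k \<in> J")
      case True
      then obtain j where j: "j \<in> J" "?m \<otimes> s k \<otimes> ?m = s j" using longest_conj_s[OF J] by blast
      have jI: "j \<in> I" using j J by blast
      have "?m \<otimes> s k = s j \<otimes> ?m" using j k m J by (metis longest_cancel(2) m_closed s_closed)
      then have "?x \<otimes> s i = s j \<otimes> ?x" using xi m jI by (simp add: coset_rep_def m_assoc)
      then show ?thesis using jI by (auto simp: ldem_def rdem_def)
    next
      case False
      then have "len ?m < len (?m \<otimes> s k)"
        using rdem_longest_iff[OF J k(1)] by (auto simp: rdem_def split: if_splits)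
      then have "\<not> len ?x < len (?x \<otimes> s i)"
        unfolding xi using len_mult_w0[of ?m] len_mult_w0[of "?m \<otimes> s k"] m k
        by (simp add: coset_rep_def)
      then show ?thesis by (simp add: rdem_def)
    qed
  qed
  then show ?thesis using x by (auto simp: slides_def)
qed

text \<open>
  Put \<open>u = x w\<^sub>0\<^sup>I\<close> and let \<open>J\<close> be its set of left descents. Write \<open>u = c b\<close> with \<open>c \<in> W\<^sub>J\<close> and
  \<open>b\<close> shortest in \<open>W\<^sub>J u\<close>; then every letter of \<open>J\<close> is a left descent of \<open>c\<close>, so \<open>c\<close> is longest.
  A right descent \<open>s\<^sub>i\<close> of \<open>b\<close> is one of \<open>u\<close>, hence corresponds to a letter lengthening \<open>x\<close> on
  the right. Sliding gives \<open>u s\<^sub>i = s\<^sub>j u\<close> with \<open>j \<in> J\<close>. Then \<open>b s\<^sub>i\<close>, which is shorter than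
  \<open>b\<close>, lies in \<open>W\<^sub>J b\<close>: a contradiction. So \<open>b\<close> has no right descent and is \<open>1\<close>.
\<close>

lemma slides_imp_coset_rep:
  assumes x: "slides x"
  shows "\<exists>J \<subseteq> I. x = coset_rep J"
proof -
  have xc: "x \<in> carrier W" using x by (simp add: slides_def)
  define u where "u = x \<otimes> w0"
  have u: "u \<in> carrier W" and xu: "x = u \<otimes> w0" using xc by (simp_all add: u_def)
  define J where "J = {i \<in> I. len (s i \<otimes> u) < len u}"
  have J: "J \<subseteq> I" by (auto simp: J_def)
  obtain a where a: "a \<in> parab J" and amin: "\<And>c. c \<in> parab J \<Longrightarrow> len (a \<otimes> u) \<le> len (c \<otimes> u)"
    using ex_has_least_nat[of "\<lambda>a. a \<in> parab J" \<one> "\<lambda>a. len (a \<otimes> u)"] generate.one by blast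
  define b where "b = a \<otimes> u"
  define c where "c = inv a"
  have ac: "a \<in> carrier W" using a parab_closed[OF J] by blast
  have b: "b \<in> carrier W" using ac u by (simp add: b_def)
  have c: "c \<in> parab J" "c \<in> carrier W" using a ac parab_inv[OF J] by (auto simp: c_def)
  have ucb: "u = c \<otimes> b" using ac u by (simp add: b_def c_def m_assoc[symmetric])
  have bmin: "len b \<le> len (d \<otimes> b)" if "d \<in> parab J" for d
    using amin[OF parab_mult[OF that a]] that parab_closed[OF J] ac u by (simp add: b_def m_assoc)
  have add: "len (d \<otimes> b) = len d + len b" if "d \<in> parab J" for d
    using coset_min_additive[OF J b _ that] bmin by blast
  have "c = longest J"
  proof (rule longest_eqI_left[OF J c(1)])
    fix i assume i: "i \<in> J"
    then have iI: "i \<in> I" and "len (s i \<otimes> u) < len u" by (auto simp: J_def)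
    then have "len (s i \<otimes> c \<otimes> b) < len (c \<otimes> b)" using c b by (simp add: ucb m_assoc)
    then have "len (s i \<otimes> c) < len c"
      using add[OF c(1)] add[OF parab_mult[OF s_parab[OF i] c(1)]] by simp
    then show "ldem i c = c" by (simp add: ldem_def)
  qed
  moreover have "b = \<one>"
  proof (rule ccontr)
    assume "b \<noteq> \<one>"
    then obtain i where i: "i \<in> I" "len (b \<otimes> s i) < len b" using ex_right_descent[OF b] by blast
    have "u \<otimes> s i = c \<otimes> (b \<otimes> s i)" using c b i by (simp add: ucb m_assoc)
    then have ui: "len (u \<otimes> s i) < len u"
      using len_mult_le[of c "b \<otimes> s i"] add[OF c(1)] c b i by (simp add: ucb)
    obtain k where k: "k \<in> I" "w0 \<otimes> s i \<otimes> w0 = s k" using w0_conj_s[OF i(1)] by blast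
    have xk: "x \<otimes> s k = u \<otimes> s i \<otimes> w0" using u i by (simp add: xu k(2)[symmetric] m_assoc)
    have "len x < len (x \<otimes> s k)"
      unfolding xk using len_mult_w0[OF u] len_mult_w0[of "u \<otimes> s i"] u i ui by (simp add: xu)
    then have rk: "rdem k x = x \<otimes> s k" "rdem k x \<noteq> x" by (auto simp: rdem_def)
    then obtain j where j: "j \<in> I" "rdem k x = ldem j x" using x k by (auto simp: slides_def)
    then have "x \<otimes> s k = s j \<otimes> x" using rk by (auto simp: ldem_def split: if_splits)
    then have "x \<otimes> s k \<otimes> w0 = s j \<otimes> x \<otimes> w0" by simp
    then have us: "u \<otimes> s i = s j \<otimes> u" using xk u i j xc by (simp add: u_def m_assoc longest_square)
    then have jJ: "j \<in> J" using ui j by (simp add: J_def)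
    let ?d = "inv c \<otimes> s j \<otimes> c"
    have "?d \<in> parab J" using c jJ J by (intro parab_mult parab_inv s_parab)
    moreover have "?d \<otimes> b = b \<otimes> s i"
    proof -
      have "?d \<otimes> b = inv c \<otimes> (s j \<otimes> u)" using c b j by (simp add: ucb m_assoc)
      also have "\<dots> = inv c \<otimes> (c \<otimes> (b \<otimes> s i))"
        unfolding us[symmetric] using c b i by (simp add: ucb m_assoc)
      finally show ?thesis using c b i by (simp add: m_assoc[symmetric])
    qed
    ultimately show False using bmin[of ?d] i by simp
  qed
  ultimately have "x = coset_rep J" using xu ucb c by (simp add: coset_rep_def)
  then show ?thesis using J by blast
qed

lemma coset_rep_closed [simp]: "J \<subseteq> I \<Longrightarrow> coset_rep J \<in> carrier W"
  by (simp add: coset_rep_def)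

lemma dual_coset_rep: "J \<subseteq> I \<Longrightarrow> dual (coset_rep J) = coset_rep J"
  by (simp add: dual_def coset_rep_def inv_mult_group longest_inv)

lemma coset_rep_dmult:
  assumes "J \<subseteq> I" "K \<subseteq> I"
  shows "\<exists>L \<subseteq> I. coset_rep J \<star> coset_rep K = coset_rep L"
  using assms slides_imp_coset_rep[OF slides_dmult] slides_coset_rep by blast

text \<open>
  The product is fixed by the anti-automorphism \<open>dual\<close>, and so are its factors, which \<open>dual\<close>
  swaps.
\<close>

lemma coset_rep_commute:
  assumes "J \<subseteq> I" "K \<subseteq> I"
  shows "coset_rep J \<star> coset_rep K = coset_rep K \<star> coset_rep J"
proof -
  obtain L where L: "L \<subseteq> I" "coset_rep J \<star> coset_rep K = coset_rep L"
    using coset_rep_dmult[OF assms] by blast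
  then have "coset_rep J \<star> coset_rep K = dual (coset_rep J \<star> coset_rep K)"
    by (simp add: dual_coset_rep)
  also have "\<dots> = coset_rep K \<star> coset_rep J"
    using assms by (simp add: dual_dmult dual_coset_rep)
  finally show ?thesis .
qed

lemma coset_rep_I: "coset_rep I = \<one>"
  by (simp add: coset_rep_def longest_square)

lemma inj_on_coset_rep: "inj_on coset_rep (Pow I)"
proof (rule inj_onI)
  fix J K assume JK: "J \<in> Pow I" "K \<in> Pow I" "coset_rep J = coset_rep K"
  then have "longest J = longest K" by (simp add: coset_rep_def)
  then show "J = K" using longest_inj JK by simp
qed

definition subset_star :: "'i set \<Rightarrow> 'i set \<Rightarrow> 'i set" where
  "subset_star J K = inv_into (Pow I) coset_rep (coset_rep J \<star> coset_rep K)"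

lemma subset_star:
  assumes "J \<subseteq> I" "K \<subseteq> I"
  shows "subset_star J K \<subseteq> I" "coset_rep (subset_star J K) = coset_rep J \<star> coset_rep K"
proof -
  have "coset_rep J \<star> coset_rep K \<in> coset_rep ` Pow I"
    using coset_rep_dmult[OF assms] by auto
  from inv_into_into[OF this] f_inv_into_f[OF this]
  show "subset_star J K \<subseteq> I" "coset_rep (subset_star J K) = coset_rep J \<star> coset_rep K"
    by (simp_all add: subset_star_def)
qed

lemma comm_monoid_subset_star: "comm_monoid \<lparr>carrier = Pow I, mult = subset_star, one = I\<rparr>"
proof -
  have eqI: "J = K" if "J \<subseteq> I" "K \<subseteq> I" "coset_rep J = coset_rep K" for J K
    using inj_on_coset_rep that by (auto dest: inj_onD)
  show ?thesis
  proof (rule comm_monoidI; simp add: subset_star(1))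
    fix J K L assume "J \<subseteq> I" "K \<subseteq> I" "L \<subseteq> I"
    then show "subset_star (subset_star J K) L = subset_star J (subset_star K L)"
      by (intro eqI) (simp_all add: subset_star dmult_assoc)
  next
    fix J assume "J \<subseteq> I"
    then show "subset_star I J = J"
      by (intro eqI) (simp_all add: subset_star coset_rep_I)
  next
    fix J K assume "J \<subseteq> I" "K \<subseteq> I"
    then show "subset_star J K = subset_star K J"
      by (intro eqI) (simp_all add: subset_star coset_rep_commute)
  qed
qed

lemma submonoid_coset_reps: "submonoid (coset_rep ` Pow I) (star_monoid W I s)"
proof (rule submonoid.intro)
  fix x y assume "x \<in> coset_rep ` Pow I" "y \<in> coset_rep ` Pow I"
  then obtain J K where "J \<subseteq> I" "K \<subseteq> I" "x = coset_rep J" "y = coset_rep K" by auto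
  then show "x \<otimes>\<^bsub>star_monoid W I s\<^esub> y \<in> coset_rep ` Pow I"
    using coset_rep_dmult[of J K] by (auto simp: star_monoid_def star_mult_eq)
next
  show "\<one>\<^bsub>star_monoid W I s\<^esub> \<in> coset_rep ` Pow I"
    using coset_rep_I by (auto simp: star_monoid_def image_iff intro!: bexI[of _ I])
qed (auto simp: star_monoid_def)

lemma comm_monoid_coset_reps:
  "comm_monoid (star_monoid W I s\<lparr>carrier := coset_rep ` Pow I\<rparr>)"
proof (rule comm_monoidI)
  show "\<one>\<^bsub>star_monoid W I s\<lparr>carrier := coset_rep ` Pow I\<rparr>\<^esub>
      \<in> carrier (star_monoid W I s\<lparr>carrier := coset_rep ` Pow I\<rparr>)"
    using submonoid.one_closed[OF submonoid_coset_reps] by simp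
qed (use submonoid.m_closed[OF submonoid_coset_reps] in
    \<open>auto simp: star_monoid_def star_mult_eq dmult_assoc coset_rep_commute\<close>)

end

theorem theorem1:
  fixes W :: "('w, 'm) monoid_scheme" and I :: "'i set" and s :: "'i \<Rightarrow> 'w"
  assumes "coxeter_system W I s" and "finite (carrier W)"
  defines "w0 \<equiv> longest_elt W I s"
    and "T' \<equiv> hecke_T' W I s"
    and "S \<equiv> {longest_elt W I s J \<otimes>\<^bsub>W\<^esub> longest_elt W I s I | J. J \<subseteq> I}"
  shows "submonoid S (star_monoid W I s) \<and>
    comm_monoid (star_monoid W I s\<lparr>carrier := S\<rparr>) \<and>
    (\<exists>star e. comm_monoid \<lparr>carrier = Pow I, mult = star, one = e\<rparr> \<and>
      (\<forall>J1 J2. J1 \<subseteq> I \<longrightarrow> J2 \<subseteq> I \<longrightarrow>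
        T' (w0 J1 \<otimes>\<^bsub>W\<^esub> w0 I) \<otimes>\<^bsub>hecke0 W I s\<^esub> T' (w0 J2 \<otimes>\<^bsub>W\<^esub> w0 I)
          = T' (w0 (star J1 J2) \<otimes>\<^bsub>W\<^esub> w0 I)))"
proof -
  interpret finite_coxeter_system W I s
    using assms(1,2) by (simp add: finite_coxeter_system_def finite_coxeter_system_axioms_def)
  have S: "S = coset_rep ` Pow I"
    by (auto simp: S_def coset_rep_def)
  have "T' (w0 J1 \<otimes>\<^bsub>W\<^esub> w0 I) \<otimes>\<^bsub>hecke0 W I s\<^esub> T' (w0 J2 \<otimes>\<^bsub>W\<^esub> w0 I) =
      T' (w0 (subset_star J1 J2) \<otimes>\<^bsub>W\<^esub> w0 I)"
    if "J1 \<subseteq> I" "J2 \<subseteq> I" for J1 J2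
    using that subset_star(2)[OF that] hecke_T'_mult[of "coset_rep J1" "coset_rep J2"]
    by (simp add: T'_def w0_def coset_rep_def)
  then show ?thesis
    unfolding S using submonoid_coset_reps comm_monoid_coset_reps comm_monoid_subset_star by blast
qed

end
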